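(* For $n\ge 3$, let $T^n=\{3^{n-1}\}$ be the $n$-simplex, $B^n=\{4,3^{n-2}\}$ the $n$-cube and $C^n=\{3^{n-2},4\}$ the $n$-cross-polytope. Then \begin{align*} \Gamma^+(T^n\diamond B^n)&=\Gamma^+(T^n)\times\Gamma^+(B^n),\\ \Gamma^+(T^n\diamond C^n)&=\Gamma^+(T^n)\times\Gamma^+(C^n),\\ \Gamma^+(B^n\diamond C^n)&=\Gamma^+(B^n)\times\Gamma^+(C^n),\\ \Gamma^+(T^n\diamond B^n\diamond C^n)&=\Gamma^+(T^n)\times\Gamma^+(B^n)\times\Gamma^+(C^n). \end{align*}
   Context: $T^n,B^n,C^n$ are the (face lattices of the) regular convex $n$-polytopes of Schläfli types $\{3,\dots,3\}$, $\{4,3,\dots,3\}$, $\{3,\dots,3,4\}$ ($n-1$ entries each). For such a regular polytope $\mathcal P$ with a fixed base flag $\Phi$, its automorphism group $\Gamma(\mathcal P)$ is the Coxeter group $\langle\rho_0,\dots,\rho_{n-1}\rangle$, where $\rho_i$ maps $\Phi$ to the unique flag differing from $\Phi$ exactly in its $i$-face; $\rho_{i-1}\rho_i$ has order equal to the $i$-th entry of the Schläfli type. Put $\sigma_i=\rho_{i-1}\rho_i$ for $1\le i\le n-1$; the rotation group is $\Gamma^+(\mathcal P)=\langle\sigma_1,\dots,\sigma_{n-1}\rangle$, of index 2 in $\Gamma(\mathcal P)$. For such polytopes $\mathcal P_1,\dots,\mathcal P_m$ of the same rank $n$, with rotation-group generators $\sigma_1^{(r)},\dots,\sigma_{n-1}^{(r)}$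 for $\mathcal P_r$, the rotation group of the mix is the subgroup $\Gamma^+(\mathcal P_1\diamond\cdots\diamond\mathcal P_m)=\Gamma^+(\mathcal P_1)\diamond\cdots\diamond\Gamma^+(\mathcal P_m)$ of the direct product $\Gamma^+(\mathcal P_1)\times\cdots\times\Gamma^+(\mathcal P_m)$ generated by the elements $\beta_i=(\sigma_i^{(1)},\dots,\sigma_i^{(m)})$, $1\le i\le n-1$. The equalities in the claim say that this subgroup is the whole direct product. *)

theory Defs
  imports "HOL-Analysis.Analysis" "HOL-Algebra.Algebra"
begin

section \<open>Face lattices of convex polytopes, flags and automorphisms\<close>

text \<open>
  The face lattice of a convex polytope \<open>P\<close> is the set of all its faces, including the improper
  faces \<open>{}\<close> and \<open>P\<close>, ordered by inclusion. The rank of a face \<open>F\<close> is \<open>aff_dim F\<close>, so the least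
  face has rank \<open>-1\<close>.
\<close>

definition faces :: "'a::euclidean_space set \<Rightarrow> 'a set set"
  where "faces P = {F. F face_of P}"

definition flag :: "'a::euclidean_space set \<Rightarrow> 'a set set \<Rightarrow> bool"
  where "flag P \<Phi> \<longleftrightarrow> subset.maxchain (faces P) \<Phi>"

text \<open>The two flags have the same \<open>j\<close>-face precisely for \<open>j \<noteq> i\<close>.\<close>

definition differ_exactly_in :: "nat \<Rightarrow> 'a::euclidean_space set set \<Rightarrow> 'a set set \<Rightarrow> bool"
  where "differ_exactly_in i \<Phi> \<Psi> \<longleftrightarrow>
    (\<forall>j::nat. {F \<in> \<Phi>. aff_dim F = int j} = {F \<in> \<Psi>. aff_dim F = int j} \<longleftrightarrow> j \<noteq> i)"

definition adjacent_flag :: "'a::euclidean_space set \<Rightarrow> 'a set set \<Rightarrow> nat \<Rightarrow> 'a set set"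
  where "adjacent_flag P \<Phi> i = (THE \<Psi>. flag P \<Psi> \<and> differ_exactly_in i \<Phi> \<Psi>)"

text \<open>
  Automorphisms are the order automorphisms of the face lattice (extended by \<open>undefined\<close> outside it),
  so this is the combinatorial, not the metrical, symmetry group. As in \<^const>\<open>BijGroup\<close>, a product
  applies the right-hand factor first. Under the opposite convention each \<open>sigma P \<Phi> i\<close> would be
  replaced by its inverse, so the generated subgroups below would be the same.
\<close>

definition Aut :: "'a::euclidean_space set \<Rightarrow> ('a set \<Rightarrow> 'a set) monoid"
  where "Aut P = BijGroup (faces P)
    \<lparr>carrier := {f \<in> Bij (faces P). \<forall>F \<in> faces P. \<forall>G \<in> faces P. f F \<subseteq> f G \<longleftrightarrow> F \<subseteq> G}\<rparr>"

definition rho :: "'a::euclidean_space set \<Rightarrow> 'a set set \<Rightarrow> nat \<Rightarrow> 'a set \<Rightarrow> 'a set"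
  where "rho P \<Phi> i = (THE f. f \<in> carrier (Aut P) \<and> f ` \<Phi> = adjacent_flag P \<Phi> i)"

definition sigma :: "'a::euclidean_space set \<Rightarrow> 'a set set \<Rightarrow> nat \<Rightarrow> 'a set \<Rightarrow> 'a set"
  where "sigma P \<Phi> i = rho P \<Phi> (i - 1) \<otimes>\<^bsub>Aut P\<^esub> rho P \<Phi> i"

text \<open>The rotation group of a polytope of rank \<open>n\<close>, given together with a base flag.\<close>

definition rotation_group ::
    "nat \<Rightarrow> 'a::euclidean_space set \<times> 'a set set \<Rightarrow> ('a set \<Rightarrow> 'a set) monoid"
  where "rotation_group n = (\<lambda>(P, \<Phi>). (Aut P)
    \<lparr>carrier := generate (Aut P) {sigma P \<Phi> i | i. 1 \<le> i \<and> i \<le> n - 1}\<rparr>)"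

section \<open>The mix\<close>

text \<open>
  A list of length \<open>m\<close> represents polytopes \<open>P\<^sub>0, \<dots>, P\<^sub>m\<^sub>-\<^sub>1\<close> of the same rank \<open>n\<close>, each with its base
  flag. Elements of the direct product are functions on the index set \<open>{..<m}\<close>.
\<close>

definition rotation_group_product ::
    "nat \<Rightarrow> ('a::euclidean_space set \<times> 'a set set) list \<Rightarrow> (nat \<Rightarrow> 'a set \<Rightarrow> 'a set) monoid"
  where "rotation_group_product n Ps =
    product_group {..<length Ps} (\<lambda>r. rotation_group n (Ps ! r))"

definition beta ::
    "('a::euclidean_space set \<times> 'a set set) list \<Rightarrow> nat \<Rightarrow> nat \<Rightarrow> 'a set \<Rightarrow> 'a set"
  where "beta Ps i = (\<lambda>r \<in> {..<length Ps}. sigma (fst (Ps ! r)) (snd (Ps ! r)) i)"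

definition rotation_group_mix ::
    "nat \<Rightarrow> ('a::euclidean_space set \<times> 'a set set) list \<Rightarrow> (nat \<Rightarrow> 'a set \<Rightarrow> 'a set) monoid"
  where "rotation_group_mix n Ps = (rotation_group_product n Ps)
    \<lparr>carrier := generate (rotation_group_product n Ps) {beta Ps i | i. 1 \<le> i \<and> i \<le> n - 1}\<rparr>"

section \<open>The three regular polytopes in Euclidean \<open>n\<close>-space, where \<open>n = DIM('a)\<close>\<close>

text \<open>
  The vertices of the simplex are the \<open>n\<close> standard basis vectors and the point with all coordinates
  equal to \<open>c = (1 - sqrt (n + 1)) / n\<close>. As \<open>n * c\<^sup>2 - 2 * c - 1 = 0\<close>, this point has distance
  \<open>sqrt 2\<close> from every basis vector, so all edges have the same length.
\<close>

definition regular_simplex :: "'a::euclidean_space set"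
  where "regular_simplex =
    convex hull (insert (((1 - sqrt (real DIM('a) + 1)) / real DIM('a)) *\<^sub>R One) Basis)"

definition cube :: "'a::euclidean_space set"
  where "cube = cbox (- One) One"

definition cross_polytope :: "'a::euclidean_space set"
  where "cross_polytope = convex hull (Basis \<union> uminus ` Basis)"

end

theory Submission
  imports Defs
begin

text \<open>
  The theorem rests on relations between the generating rotations. In the rotation groups of all three
  polytopes \<open>(\<sigma>\<^sub>i \<sigma>\<^sub>i\<^sub>+\<^sub>1)\<^sup>2 = 1\<close>, and \<open>\<sigma>\<^sub>i\<^sup>3 = 1\<close> except that \<open>\<sigma>\<^sub>1\<close> of the cube and
  \<open>\<sigma>\<^sub>n\<^sub>-\<^sub>1\<close> of the cross-polytope satisfy \<open>\<sigma>\<^sup>4 = 1\<close>. As \<open>n \<ge> 3\<close>, these exceptions occur at different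
  indices. Therefore the power \<open>-3\<close> of the diagonal generator \<open>\<beta>\<^sub>1\<close> has the coordinate \<open>\<sigma>\<^sub>1\<close> in the cube
  and is trivial elsewhere; likewise \<open>\<beta>\<^sub>n\<^sub>-\<^sub>1\<close> isolates \<open>\<sigma>\<^sub>n\<^sub>-\<^sub>1\<close> of the cross-polytope
  (\<open>single_isolate\<close>). If \<open>x\<close> and \<open>y\<close> are neighbouring generators of one factor, with
  \<open>(x y)\<^sup>2 = 1\<close> and \<open>y\<^sup>3 = 1\<close>, then \<open>y = y\<^sup>-\<^sup>1 x y x\<close>; so the mix contains \<open>y\<close> in this coordinate as
  soon as it contains \<open>x\<close> (\<open>single_step\<close>). In this way it contains the whole factors of the cube and
  of the cross-polytope, and dividing the \<open>\<beta>\<^sub>i\<close> by their coordinates there yields the factor of the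
  simplex (\<open>single_last_factor\<close>, \<open>mix_eq_product\<close>).

  The relations have to be derived from the face lattices. A lattice that consists of the simplices of
  a complex and a top element is the face lattice of the simplex (all proper subsets of \<open>n + 1\<close>
  points), of the cross-polytope (sets of signed basis vectors without antipodal pairs), and, with the
  order reversed, of the cube. In such a lattice a flag is an ordering of the vertices of a facet, and
  an automorphism is a permutation of the vertices that is determined by the image of one flag
  (\<open>order_auto_vertex_map\<close>, \<open>order_auto_fixing_flag\<close>). Hence \<open>\<rho>\<^sub>i\<close> is induced by every symmetry
  of the complex that takes the base flag to the adjacent one (\<open>rho_eq\<close>): by a transposition of two consecutive
  vertices for the simplex, and by a signed permutation of the basis for the other two polytopes. For
  these permutations the relations are a computation.
\<close>

section \<open>Subgroups of a direct product generated by diagonal elements\<close>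

locale group_mix =
  fixes I :: "'i set" and G :: "'i \<Rightarrow> 'b monoid" and J :: "'j set" and s :: "'i \<Rightarrow> 'j \<Rightarrow> 'b"
  assumes finite_index: "finite I"
    and group_factor: "r \<in> I \<Longrightarrow> group (G r)"
    and gen_closed: "r \<in> I \<Longrightarrow> j \<in> J \<Longrightarrow> s r j \<in> carrier (G r)"
    and factor_generated: "r \<in> I \<Longrightarrow> carrier (G r) \<subseteq> generate (G r) (s r ` J)"
begin

abbreviation "prod_grp \<equiv> product_group I G"

definition diag where "diag j = (\<lambda>r\<in>I. s r j)"

definition single where "single r x = (\<lambda>q\<in>I. if q = r then x else \<one>\<^bsub>G q\<^esub>)"

definition mix where "mix = generate prod_grp (diag ` J)"

sublocale P: group prod_grp
  by (simp add: group_factor)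

lemma diag_closed: "j \<in> J \<Longrightarrow> diag j \<in> carrier prod_grp"
  by (auto simp: diag_def gen_closed)

lemma single_closed: "r \<in> I \<Longrightarrow> x \<in> carrier (G r) \<Longrightarrow> single r x \<in> carrier prod_grp"
  by (auto simp: single_def group_factor group.is_monoid monoid.one_closed)

lemma mix_subgroup: "subgroup mix prod_grp"
  unfolding mix_def by (rule P.generate_is_subgroup) (use diag_closed in blast)

lemma diag_in_mix: "j \<in> J \<Longrightarrow> diag j \<in> mix"
  by (auto simp: mix_def intro: generate.incl)

lemmas mix_mult = subgroup.m_closed [OF mix_subgroup]
  and mix_inv = subgroup.m_inv_closed [OF mix_subgroup]
  and mix_one = subgroup.one_closed [OF mix_subgroup]

lemma single_mult:
  assumes "r \<in> I" "x \<in> carrier (G r)" "y \<in> carrier (G r)"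
  shows "single r (x \<otimes>\<^bsub>G r\<^esub> y) = single r x \<otimes>\<^bsub>prod_grp\<^esub> single r y"
  by (auto simp: single_def fun_eq_iff group_factor group.is_monoid monoid.l_one monoid.one_closed)

lemma single_inv:
  assumes "r \<in> I" "x \<in> carrier (G r)"
  shows "single r (inv\<^bsub>G r\<^esub> x) = inv\<^bsub>prod_grp\<^esub> (single r x)"
  using single_closed[OF assms] assms
  by (auto simp: inv_product_group group_factor single_def fun_eq_iff group.is_monoid monoid.inv_one)

lemma single_in_mix:
  assumes r: "r \<in> I" and gens: "\<And>j. j \<in> J \<Longrightarrow> single r (s r j) \<in> mix" and x: "x \<in> carrier (G r)"
  shows "single r x \<in> mix"
proof -
  interpret G: group "G r" using r by (rule group_factor)
  have sub: "s r ` J \<subseteq> carrier (G r)" using gen_closed r by blast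
  have "x \<in> generate (G r) (s r ` J)" using factor_generated r x by blast
  then show ?thesis
  proof (induction x rule: generate.induct)
    case one
    have "single r \<one>\<^bsub>G r\<^esub> = \<one>\<^bsub>prod_grp\<^esub>" by (auto simp: single_def fun_eq_iff)
    then show ?case using mix_one by (simp only:)
  next
    case (incl h) then show ?case using gens by blast
  next
    case (inv h)
    then show ?case using gens sub r by (auto simp: single_inv subset_iff intro!: mix_inv)
  next
    case (eng h1 h2)
    then show ?case
      unfolding single_mult[OF r G.generate_in_carrier[OF sub eng.hyps(1)] G.generate_in_carrier[OF sub eng.hyps(2)]]
      by (intro mix_mult)
  qed
qed

lemma mix_eqI:
  assumes "\<And>r j. r \<in> I \<Longrightarrow> j \<in> J \<Longrightarrow> single r (s r j) \<in> mix"
  shows "mix = carrier prod_grp"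
proof
  show "mix \<subseteq> carrier prod_grp" by (rule subgroup.subset [OF mix_subgroup])
next
  show "carrier prod_grp \<subseteq> mix"
  proof
    fix x assume x: "x \<in> carrier prod_grp"
    have "(\<lambda>q\<in>I. if q \<in> A then x q else \<one>\<^bsub>G q\<^esub>) \<in> mix" if "finite A" "A \<subseteq> I" for A
      using that
    proof (induction A rule: finite_induct)
      case empty
      then show ?case using mix_one by (simp add: restrict_def)
    next
      case (insert r A)
      have "(\<lambda>q\<in>I. if q \<in> insert r A then x q else \<one>\<^bsub>G q\<^esub>) =
          single r (x r) \<otimes>\<^bsub>prod_grp\<^esub> (\<lambda>q\<in>I. if q \<in> A then x q else \<one>\<^bsub>G q\<^esub>)"
        using insert.hyps x
        by (auto simp: single_def fun_eq_iff group_factor group.is_monoid monoid.l_one monoid.r_one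
            monoid.one_closed PiE_iff)
      moreover have "single r (x r) \<in> mix"
      proof (rule single_in_mix)
        show "r \<in> I" using insert.prems by blast
        then show "x r \<in> carrier (G r)" using x by (simp add: PiE_iff)
      qed (use insert.prems assms in blast)
      moreover have "(\<lambda>q\<in>I. if q \<in> A then x q else \<one>\<^bsub>G q\<^esub>) \<in> mix"
        using insert.prems by (intro insert.IH) blast
      ultimately show ?case using mix_mult by (simp only:)
    qed
    from this[OF finite_index] have "(\<lambda>q\<in>I. if q \<in> I then x q else \<one>\<^bsub>G q\<^esub>) \<in> mix" by simp
    moreover have "(\<lambda>q\<in>I. if q \<in> I then x q else \<one>\<^bsub>G q\<^esub>) = x"
      using x by (auto simp: fun_eq_iff PiE_iff extensional_def)
    ultimately show "x \<in> mix" by simp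
  qed
qed

text \<open>
  Dividing \<open>diag j\<close> by all of its coordinates except the one at \<open>r0\<close> leaves \<open>single r0 (s r0 j)\<close>.
\<close>

lemma single_last_factor:
  assumes r0: "r0 \<in> I" and j: "j \<in> J"
    and others: "\<And>r. r \<in> I - {r0} \<Longrightarrow> single r (s r j) \<in> mix"
  shows "single r0 (s r0 j) \<in> mix"
proof -
  have "(\<lambda>q\<in>I. if q \<in> A then \<one>\<^bsub>G q\<^esub> else s q j) \<in> mix" if "finite A" "A \<subseteq> I - {r0}" for A
    using that
  proof (induction A rule: finite_induct)
    case empty
    then show ?case using diag_in_mix[OF j] by (simp add: diag_def restrict_def)
  next
    case (insert r A)
    let ?d = "\<lambda>q\<in>I. if q \<in> A then \<one>\<^bsub>G q\<^esub> else s q j"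
    have r: "r \<in> I" using insert.prems by blast
    have eq: "(\<lambda>q\<in>I. if q \<in> insert r A then \<one>\<^bsub>G q\<^esub> else s q j) =
        inv\<^bsub>prod_grp\<^esub> (single r (s r j)) \<otimes>\<^bsub>prod_grp\<^esub> ?d"
      unfolding single_inv[OF r gen_closed[OF r j], symmetric]
      using insert.hyps j
      by (auto simp: single_def fun_eq_iff group_factor group.is_monoid monoid.l_one gen_closed
          monoid.one_closed group.l_inv)
    have "single r (s r j) \<in> mix" using insert.prems by (intro others) blast
    then have "inv\<^bsub>prod_grp\<^esub> (single r (s r j)) \<in> mix" by (rule mix_inv)
    moreover have "?d \<in> mix" using insert.prems by (intro insert.IH) blast
    ultimately show ?case unfolding eq by (rule mix_mult)
  qed
  from this[of "I - {r0}"] finite_index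
  have "(\<lambda>q\<in>I. if q \<in> I - {r0} then \<one>\<^bsub>G q\<^esub> else s q j) \<in> mix" by simp
  moreover have "(\<lambda>q\<in>I. if q \<in> I - {r0} then \<one>\<^bsub>G q\<^esub> else s q j) = single r0 (s r0 j)"
    by (auto simp: single_def fun_eq_iff)
  ultimately show ?thesis by simp
qed

text \<open>
  Write \<open>x = s r i\<close> and \<open>y = s r k\<close>. From \<open>(x y)\<^sup>2 = 1\<close> and \<open>y\<^sup>3 = 1\<close> follows
  \<open>y = y\<^sup>-\<^sup>1 x y x\<close>. If \<open>y\<close> is replaced by \<open>diag k\<close> and \<open>x\<close> by \<open>single r x\<close>, the right-hand side
  becomes trivial in all coordinates other than \<open>r\<close>. So a single relation carries membership in the
  mix from one generator of a factor to the next.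
\<close>

lemma single_step:
  assumes r: "r \<in> I" and i: "i \<in> J" and k: "k \<in> J"
    and mem: "single r (s r i) \<in> mix"
    and order2: "(s r i \<otimes>\<^bsub>G r\<^esub> s r k) [^]\<^bsub>G r\<^esub> (2::nat) = \<one>\<^bsub>G r\<^esub>"
    and order3: "s r k [^]\<^bsub>G r\<^esub> (3::nat) = \<one>\<^bsub>G r\<^esub>"
  shows "single r (s r k) \<in> mix"
proof -
  interpret G: group "G r" using r by (rule group_factor)
  let ?x = "s r i" and ?y = "s r k"
  have c: "?x \<in> carrier (G r)" "?y \<in> carrier (G r)" using gen_closed r i k by auto
  have 2: "?x \<otimes>\<^bsub>G r\<^esub> (?y \<otimes>\<^bsub>G r\<^esub> (?x \<otimes>\<^bsub>G r\<^esub> ?y)) = \<one>\<^bsub>G r\<^esub>"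
    using order2 c by (simp add: numeral_2_eq_2 G.m_assoc)
  have 3: "?y \<otimes>\<^bsub>G r\<^esub> (?y \<otimes>\<^bsub>G r\<^esub> ?y) = \<one>\<^bsub>G r\<^esub>"
    using order3 c by (simp add: numeral_3_eq_3 G.m_assoc)
  have "?x \<otimes>\<^bsub>G r\<^esub> ?y \<otimes>\<^bsub>G r\<^esub> ?x = inv\<^bsub>G r\<^esub> ?y"
    using 2 c by (intro G.inv_equality [symmetric]) (simp_all add: G.m_assoc)
  moreover have "inv\<^bsub>G r\<^esub> ?y = ?y \<otimes>\<^bsub>G r\<^esub> ?y"
    using 3 c by (intro G.inv_equality) (simp_all add: G.m_assoc)
  ultimately have eq: "inv\<^bsub>G r\<^esub> ?y \<otimes>\<^bsub>G r\<^esub> ?x \<otimes>\<^bsub>G r\<^esub> ?y \<otimes>\<^bsub>G r\<^esub> ?x = ?y"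
    using c 3 by (simp add: G.m_assoc)
  have prod_eq: "inv\<^bsub>prod_grp\<^esub> diag k \<otimes>\<^bsub>prod_grp\<^esub> single r ?x \<otimes>\<^bsub>prod_grp\<^esub> diag k \<otimes>\<^bsub>prod_grp\<^esub> single r ?x
      = single r ?y"
    using eq diag_closed[OF k]
    by (auto simp: inv_product_group group_factor diag_def single_def fun_eq_iff group.is_monoid
        monoid.r_one monoid.l_one gen_closed k monoid.one_closed group.l_inv group.inv_closed)
  show ?thesis
    unfolding prod_eq [symmetric] by (intro mix_mult mix_inv mem diag_in_mix[OF k])
qed

text \<open>
  Where the orders of the \<open>j\<close>-th generators divide 4 in the factor \<open>r\<close> and 3 in all other factors,
  the power \<open>-3\<close> of \<open>diag j\<close> separates the factor \<open>r\<close> from the others.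
\<close>

lemma single_isolate:
  assumes r: "r \<in> I" and j: "j \<in> J"
    and order4: "s r j [^]\<^bsub>G r\<^esub> (4::nat) = \<one>\<^bsub>G r\<^esub>"
    and order3: "\<And>q. q \<in> I - {r} \<Longrightarrow> s q j [^]\<^bsub>G q\<^esub> (3::nat) = \<one>\<^bsub>G q\<^esub>"
  shows "single r (s r j) \<in> mix"
proof -
  interpret G: group "G r" using r by (rule group_factor)
  have c: "s r j \<in> carrier (G r)" using gen_closed r j by auto
  let ?b = "diag j \<otimes>\<^bsub>prod_grp\<^esub> diag j \<otimes>\<^bsub>prod_grp\<^esub> diag j"
  have "s r j = inv\<^bsub>G r\<^esub> (s r j \<otimes>\<^bsub>G r\<^esub> s r j \<otimes>\<^bsub>G r\<^esub> s r j)"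
    using order4 c by (intro G.inv_equality [symmetric]) (simp_all add: G.m_assoc numeral_eq_Suc)
  moreover have "s q j \<otimes>\<^bsub>G q\<^esub> s q j \<otimes>\<^bsub>G q\<^esub> s q j = \<one>\<^bsub>G q\<^esub>" if "q \<in> I" "q \<noteq> r" for q
  proof -
    interpret Q: group "G q" using that by (simp add: group_factor)
    show ?thesis using order3[of q] that gen_closed[of q j] j by (simp add: numeral_3_eq_3)
  qed
  moreover have "?b \<in> carrier prod_grp" using diag_closed[OF j] P.m_closed by blast
  ultimately have inv_eq: "inv\<^bsub>prod_grp\<^esub> ?b = single r (s r j)"
    using r by (subst inv_product_group)
      (auto simp: group_factor diag_def single_def fun_eq_iff group.is_monoid monoid.inv_one)
  show ?thesis
    unfolding inv_eq [symmetric] by (intro mix_mult mix_inv diag_in_mix[OF j])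
qed

end

section \<open>Thin simplicial complexes and their flags\<close>

text \<open>
  In this form maximality depends on comparability alone, so it is visibly invariant under reversal
  of the order.
\<close>

lemma maxchain_iff:
  "subset.maxchain \<A> C \<longleftrightarrow> C \<subseteq> \<A> \<and> (\<forall>D\<in>C. \<forall>Y\<in>C. D \<subseteq> Y \<or> Y \<subseteq> D) \<and>
    (\<forall>Z\<in>\<A>. (\<forall>D\<in>C. D \<subseteq> Z \<or> Z \<subseteq> D) \<longrightarrow> Z \<in> C)"
  (is "?L \<longleftrightarrow> ?R")
proof -
  have ch: "subset.chain \<A> E \<longleftrightarrow> E \<subseteq> \<A> \<and> (\<forall>D\<in>E. \<forall>Y\<in>E. D \<subseteq> Y \<or> Y \<subseteq> D)" for E
    by (simp add: subset_chain_def)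
  show ?thesis
  proof
    assume L: ?L
    then have C: "subset.chain \<A> C" and mx: "\<And>S. subset.chain \<A> S \<Longrightarrow> C \<subset> S \<Longrightarrow> False"
      by (auto simp: subset.maxchain_def)
    have "Z \<in> C" if "Z \<in> \<A>" "\<forall>D\<in>C. D \<subseteq> Z \<or> Z \<subseteq> D" for Z
    proof (rule ccontr)
      assume "Z \<notin> C"
      then have "C \<subset> insert Z C" by blast
      moreover have "subset.chain \<A> (insert Z C)"
        using C that unfolding ch by simp blast
      ultimately show False using mx by blast
    qed
    with C show ?R unfolding ch by simp
  next
    assume R: ?R
    then have "subset.chain \<A> C" unfolding ch by simp
    moreover have "\<not> C \<subset> S" if S: "subset.chain \<A> S" for S
    proof
      assume "C \<subset> S"
      then obtain Z where Z: "Z \<in> S" "Z \<notin> C" and sub: "C \<subseteq> S" by blast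
      have "\<forall>D\<in>C. D \<subseteq> Z \<or> Z \<subseteq> D" using S Z(1) sub unfolding ch by (meson subsetD)
      moreover have "Z \<in> \<A>" using S Z(1) unfolding ch by blast
      ultimately show False using R Z(2) by blast
    qed
    ultimately show ?L by (auto simp: subset.maxchain_def)
  qed
qed

definition order_auto :: "'a set set \<Rightarrow> ('a set \<Rightarrow> 'a set) \<Rightarrow> bool" where
  "order_auto \<A> f \<longleftrightarrow> bij_betw f \<A> \<A> \<and> (\<forall>F\<in>\<A>. \<forall>G\<in>\<A>. f F \<subseteq> f G \<longleftrightarrow> F \<subseteq> G)"

definition symmetry :: "'a set \<Rightarrow> 'a set set \<Rightarrow> ('a \<Rightarrow> 'a) \<Rightarrow> bool" where
  "symmetry V K g \<longleftrightarrow> bij_betw g V V \<and> (\<forall>A\<in>K. g ` A \<in> K)"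

text \<open>
  A pure simplicial complex \<open>K\<close> with facets of \<open>n\<close> vertices, such that no ridge lies in three facets
  and a symmetry is determined by its values on a facet. Together with the additional top element \<open>V\<close>
  it models the lattice of a polytope of rank \<open>n\<close> whose proper faces are simplices: a simplex with \<open>l\<close>
  vertices has level \<open>l\<close>, that is rank \<open>l - 1\<close>, and the top element has level \<open>n + 1\<close>.
\<close>

locale thin_complex =
  fixes V :: "'a set" and K :: "'a set set" and n :: nat
  assumes finite_V: "finite V"
    and K_subset: "A \<in> K \<Longrightarrow> A \<subseteq> V"
    and V_notin_K: "V \<notin> K"
    and empty_in_K: "{} \<in> K"
    and singleton_in_K: "x \<in> V \<Longrightarrow> {x} \<in> K"
    and down_closed: "A \<in> K \<Longrightarrow> B \<subseteq> A \<Longrightarrow> B \<in> K"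
    and card_le: "A \<in> K \<Longrightarrow> card A \<le> n"
    and pure: "A \<in> K \<Longrightarrow> card A < n \<Longrightarrow> \<exists>x. x \<notin> A \<and> insert x A \<in> K"
    and thin: "card R = n - 1 \<Longrightarrow> x \<notin> R \<Longrightarrow> y \<notin> R \<Longrightarrow> z \<notin> R \<Longrightarrow>
      insert x R \<in> K \<Longrightarrow> insert y R \<in> K \<Longrightarrow> insert z R \<in> K \<Longrightarrow> x = y \<or> x = z \<or> y = z"
    and rigid: "symmetry V K g \<Longrightarrow> A \<in> K \<Longrightarrow> card A = n \<Longrightarrow> (\<And>x. x \<in> A \<Longrightarrow> g x = x) \<Longrightarrow>
      x \<in> V \<Longrightarrow> g x = x"
begin

definition lattice :: "'a set set" where "lattice = insert V K"

text \<open>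
  A flag of the lattice amounts to an ordering of the vertices of a facet, called a frame: the flag
  consists of the initial segments of the ordering and of \<open>V\<close>.
\<close>

definition frame :: "(nat \<Rightarrow> 'a) \<Rightarrow> bool" where
  "frame v \<longleftrightarrow> inj_on v {..<n} \<and> v ` {..<n} \<in> K"

definition flag_elem :: "(nat \<Rightarrow> 'a) \<Rightarrow> nat \<Rightarrow> 'a set" where
  "flag_elem v l = (if l \<le> n then v ` {..<l} else V)"

definition frame_flag :: "(nat \<Rightarrow> 'a) \<Rightarrow> 'a set set" where
  "frame_flag v = flag_elem v ` {..Suc n}"

lemma finite_K: "A \<in> K \<Longrightarrow> finite A"
  using K_subset finite_V finite_subset by blast

lemma lattice_subset: "A \<in> lattice \<Longrightarrow> A \<subseteq> V"
  using K_subset by (auto simp: lattice_def)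

lemma frame_flag_eq: "frame_flag v = insert V ((\<lambda>j. v ` {..<j}) ` {..n})"
  by (auto simp: frame_flag_def flag_elem_def image_iff le_Suc_eq)

lemma frame_inj: "frame v \<Longrightarrow> i < n \<Longrightarrow> j < n \<Longrightarrow> v i = v j \<Longrightarrow> i = j"
  unfolding frame_def by (meson inj_onD lessThan_iff)

lemma frame_segment_in_K:
  assumes "frame v" "j \<le> n" shows "v ` {..<j} \<in> K"
proof (rule down_closed)
  show "v ` {..<n} \<in> K" using assms by (simp add: frame_def)
  show "v ` {..<j} \<subseteq> v ` {..<n}" using assms by (intro image_mono) simp
qed

lemma frame_segment_card:
  assumes "frame v" "j \<le> n" shows "card (v ` {..<j}) = j"
  using assms by (subst card_image) (auto simp: frame_def intro: inj_on_subset)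

lemma flag_elem_mono:
  assumes "frame v" "l \<le> m" shows "flag_elem v l \<subseteq> flag_elem v m"
  using assms frame_segment_in_K[OF assms(1)] K_subset by (auto simp: flag_elem_def)

lemma flag_elem_inj:
  assumes "frame v" "l \<le> Suc n" "m \<le> Suc n" "flag_elem v l = flag_elem v m" shows "l = m"
proof -
  have "flag_elem v i \<noteq> flag_elem v j" if "i < j" "j \<le> Suc n" for i j
  proof (cases "j \<le> n")
    case True
    then show ?thesis
      using frame_segment_card[OF assms(1), of i] frame_segment_card[OF assms(1), of j] that
      by (auto simp: flag_elem_def)
  next
    case False
    then show ?thesis
      using frame_segment_in_K[OF assms(1), of i] V_notin_K that by (auto simp: flag_elem_def)
  qed
  then show ?thesis using assms by (metis linorder_neqE_nat)
qed

lemma flag_elem_in_lattice: "frame v \<Longrightarrow> flag_elem v l \<in> lattice"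
  using frame_segment_in_K by (auto simp: lattice_def flag_elem_def)

lemma frame_flag_comparable_mem:
  assumes v: "frame v" and Z: "Z \<in> lattice" and comp: "\<forall>D\<in>frame_flag v. D \<subseteq> Z \<or> Z \<subseteq> D"
  shows "Z \<in> frame_flag v"
proof (cases "Z = V")
  case True then show ?thesis by (simp add: frame_flag_eq)
next
  case False
  then have ZK: "Z \<in> K" using Z by (simp add: lattice_def)
  let ?D = "v ` {..<card Z}"
  have n: "card Z \<le> n" using ZK by (rule card_le)
  have "?D \<subseteq> Z \<or> Z \<subseteq> ?D" using comp n by (auto simp: frame_flag_eq)
  moreover have "card ?D = card Z" using frame_segment_card v n by blast
  ultimately have "Z = ?D" using finite_K[OF ZK] by (metis card_subset_eq finite_imageI finite_lessThan)
  then show ?thesis using n by (auto simp: frame_flag_eq)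
qed

lemma maxchain_frame_flag:
  assumes v: "frame v" shows "subset.maxchain lattice (frame_flag v)"
  unfolding maxchain_iff
proof (intro conjI ballI impI)
  show "frame_flag v \<subseteq> lattice" using flag_elem_in_lattice[OF v] by (auto simp: frame_flag_def)
next
  fix D Y assume "D \<in> frame_flag v" "Y \<in> frame_flag v"
  then show "D \<subseteq> Y \<or> Y \<subseteq> D"
    using flag_elem_mono[OF v] by (auto simp: frame_flag_def) (meson nat_le_linear subsetD)
qed (rule frame_flag_comparable_mem[OF v])

text \<open>
  Let \<open>B\<close> be the least member of the chain above \<open>A\<close>. One vertex of \<open>B\<close> can be added to \<open>A\<close>, for
  \<open>B = V\<close> by purity, and the resulting simplex is comparable with every member of the chain.
\<close>

lemma maxchain_step:
  assumes C: "subset.maxchain lattice C" and A: "A \<in> C" "A \<in> K" "card A < n"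
  shows "\<exists>x. x \<notin> A \<and> insert x A \<in> C \<and> insert x A \<in> K"
proof -
  have sub: "C \<subseteq> lattice" and chain: "\<And>D Y. D \<in> C \<Longrightarrow> Y \<in> C \<Longrightarrow> D \<subseteq> Y \<or> Y \<subseteq> D"
    and max: "\<And>Z. Z \<in> lattice \<Longrightarrow> (\<forall>D\<in>C. D \<subseteq> Z \<or> Z \<subseteq> D) \<Longrightarrow> Z \<in> C"
    using C unfolding maxchain_iff by blast+
  let ?U = "{B \<in> C. A \<subset> B}"
  have "C \<subseteq> Pow V" using sub lattice_subset by blast
  then have finU: "finite ?U" using finite_V by (intro finite_subset[of ?U "Pow V"]) auto
  have "V \<in> C" using max[of V] sub lattice_subset by (auto simp: lattice_def)
  then have "V \<in> ?U" using A K_subset V_notin_K by blast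
  then have "?U \<noteq> {}" by blast
  from finite_has_minimal[OF finU this]
  obtain B where B: "B \<in> ?U" and Bmin: "\<And>D. D \<in> ?U \<Longrightarrow> D \<subseteq> B \<Longrightarrow> D = B"
    by (elim bexE) auto
  have least: "B \<subseteq> D" if "D \<in> ?U" for D
    using chain[of B D] B Bmin[OF that] that by blast
  have "\<exists>x. x \<notin> A \<and> x \<in> B \<and> insert x A \<in> K"
  proof (cases "B = V")
    case True
    then show ?thesis using pure[OF A(2,3)] K_subset by blast
  next
    case False
    then have "B \<in> K" using B sub by (auto simp: lattice_def)
    moreover obtain x where "x \<in> B" "x \<notin> A" using B by blast
    ultimately show ?thesis using B down_closed[of B "insert x A"] by blast
  qed
  then obtain x where x: "x \<notin> A" "x \<in> B" "insert x A \<in> K" by blast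
  have "D \<subseteq> insert x A \<or> insert x A \<subseteq> D" if "D \<in> C" for D
    using chain[OF that A(1)] least[of D] that x(2) by blast
  then have "insert x A \<in> C" using max x(3) by (simp add: lattice_def)
  with x show ?thesis by blast
qed

lemma maxchain_imp_frame_flag:
  assumes C: "subset.maxchain lattice C"
  shows "\<exists>v. frame v \<and> C = frame_flag v"
proof -
  have sub: "C \<subseteq> lattice" and chain: "\<And>D Y. D \<in> C \<Longrightarrow> Y \<in> C \<Longrightarrow> D \<subseteq> Y \<or> Y \<subseteq> D"
    and max: "\<And>Z. Z \<in> lattice \<Longrightarrow> (\<forall>D\<in>C. D \<subseteq> Z \<or> Z \<subseteq> D) \<Longrightarrow> Z \<in> C"
    using C unfolding maxchain_iff by blast+
  have "\<exists>v. inj_on v {..<m} \<and> (\<forall>j\<le>m. v ` {..<j} \<in> C \<and> v ` {..<j} \<in> K)" if "m \<le> n" for m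
    using that
  proof (induction m)
    case 0
    have "{} \<in> C" using max[of "{}"] empty_in_K by (simp add: lattice_def)
    then show ?case using empty_in_K by simp
  next
    case (Suc m)
    then obtain v where v: "inj_on v {..<m}" "\<And>j. j \<le> m \<Longrightarrow> v ` {..<j} \<in> C \<and> v ` {..<j} \<in> K"
      by auto
    have "card (v ` {..<m}) < n" using v(1) Suc.prems by (simp add: card_image)
    then obtain x where x: "x \<notin> v ` {..<m}" "insert x (v ` {..<m}) \<in> C" "insert x (v ` {..<m}) \<in> K"
      using maxchain_step[OF C, of "v ` {..<m}"] v(2)[of m] by blast
    let ?w = "v(m := x)"
    have old: "?w ` {..<j} = v ` {..<j}" if "j \<le> m" for j using that by (auto simp: image_iff)
    have new: "?w ` {..<Suc m} = insert x (v ` {..<m})"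
      by (simp only: lessThan_Suc image_insert old[OF order_refl] fun_upd_same)
    have "inj_on ?w {..<Suc m}"
      using v(1) x(1) old[of m] by (auto simp: lessThan_Suc inj_on_def)
    moreover have "\<forall>j\<le>Suc m. ?w ` {..<j} \<in> C \<and> ?w ` {..<j} \<in> K"
      using old new x v(2) by (metis le_Suc_eq)
    ultimately show ?case by blast
  qed
  then obtain v where v: "inj_on v {..<n}" "\<And>j. j \<le> n \<Longrightarrow> v ` {..<j} \<in> C \<and> v ` {..<j} \<in> K"
    by blast
  then have fr: "frame v" by (simp add: frame_def)
  have "V \<in> C" using max[of V] sub lattice_subset by (auto simp: lattice_def)
  then have "frame_flag v \<subseteq> C" using v(2) by (auto simp: frame_flag_eq)
  moreover have "C \<subseteq> frame_flag v"
    using frame_flag_comparable_mem[OF fr] sub chain \<open>frame_flag v \<subseteq> C\<close> by blast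
  ultimately show ?thesis using fr by blast
qed

text \<open>
  This is the diamond property: at most two flags agree at all levels other than \<open>k\<close>. For \<open>k < n\<close> only
  two vertices are available between the levels \<open>k - 1\<close> and \<open>k + 1\<close>; for \<open>k = n\<close> thinness applies.
\<close>

lemma adjacent_frame_unique:
  assumes fr: "frame v" "frame w" "frame u" and k: "1 \<le> k" "k \<le> n"
    and vw: "\<And>l. 1 \<le> l \<Longrightarrow> l \<le> n \<Longrightarrow> l \<noteq> k \<Longrightarrow> flag_elem w l = flag_elem v l"
    and vu: "\<And>l. 1 \<le> l \<Longrightarrow> l \<le> n \<Longrightarrow> l \<noteq> k \<Longrightarrow> flag_elem u l = flag_elem v l"
  shows "flag_elem v k = flag_elem w k \<or> flag_elem v k = flag_elem u k \<or> flag_elem w k = flag_elem u k"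
proof -
  define R where "R = v ` {..<k - 1}"
  have step: "flag_elem t k = insert (t (k - 1)) (t ` {..<k - 1})" if "frame t" for t
  proof -
    have "{..<k} = insert (k - 1) {..<k - 1}" using k by auto
    then show ?thesis using k by (simp add: flag_elem_def)
  qed
  have notin: "t (k - 1) \<notin> t ` {..<k - 1}" if "frame t" for t
  proof
    assume "t (k - 1) \<in> t ` {..<k - 1}"
    then obtain i where "i < k - 1" "t (k - 1) = t i" by auto
    moreover have "k - 1 < n" "i < n" using \<open>i < k - 1\<close> k by linarith+
    ultimately show False using frame_inj[OF that, of "k - 1" i] by linarith
  qed
  have "w ` {..<k - 1} = R \<and> u ` {..<k - 1} = R"
    using vw[of "k - 1"] vu[of "k - 1"] k by (cases "k = 1") (auto simp: flag_elem_def R_def)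
  then have eqs: "flag_elem v k = insert (v (k - 1)) R" "flag_elem w k = insert (w (k - 1)) R"
      "flag_elem u k = insert (u (k - 1)) R" "v (k - 1) \<notin> R" "w (k - 1) \<notin> R" "u (k - 1) \<notin> R"
    using step[OF fr(1)] step[OF fr(2)] step[OF fr(3)] notin[OF fr(1)] notin[OF fr(2)] notin[OF fr(3)]
    by (simp_all add: R_def)
  have "v (k - 1) = w (k - 1) \<or> v (k - 1) = u (k - 1) \<or> w (k - 1) = u (k - 1)"
  proof (cases "k = n")
    case True
    have "card R = n - 1" using frame_segment_card[OF fr(1), of "k - 1"] True by (simp add: R_def)
    moreover have "flag_elem t k \<in> K" if "frame t" for t
      using frame_segment_in_K[OF that] k by (simp add: flag_elem_def)
    ultimately show ?thesis using eqs fr thin[of R "v (k-1)" "w (k-1)" "u (k-1)"] by metis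
  next
    case False
    have up: "t (k - 1) \<in> insert (v (k - 1)) (insert (v k) R)" if "flag_elem t (Suc k) = flag_elem v (Suc k)" for t
    proof -
      have "t (k - 1) \<in> flag_elem t (Suc k)" using False k by (auto simp: flag_elem_def)
      also have "flag_elem t (Suc k) = insert (v k) (flag_elem v k)"
        using that False k by (simp add: flag_elem_def lessThan_Suc)
      finally show ?thesis using eqs(1) by auto
    qed
    show ?thesis using up[of w] up[of u] vw[of "Suc k"] vu[of "Suc k"] False k eqs by auto
  qed
  then show ?thesis using eqs by metis
qed

lemma symmetry_order_auto:
  assumes "symmetry V K g" shows "order_auto lattice ((`) g)"
proof -
  have g: "inj_on g V" "g ` V = V" and K: "\<And>A. A \<in> K \<Longrightarrow> g ` A \<in> K"
    using assms by (auto simp: symmetry_def bij_betw_def)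
  have "lattice \<subseteq> Pow V" using lattice_subset by blast
  then have "finite lattice" using finite_V by (intro finite_subset[of lattice "Pow V"]) auto
  moreover have "inj_on ((`) g) lattice"
    using inj_on_subset[OF inj_on_image_Pow[OF g(1)]] \<open>lattice \<subseteq> Pow V\<close> .
  moreover have "(`) g ` lattice \<subseteq> lattice" using K g by (auto simp: lattice_def)
  ultimately have "bij_betw ((`) g) lattice lattice" by (simp add: bij_betw_def endo_inj_surj)
  moreover have "g ` F \<subseteq> g ` G \<longleftrightarrow> F \<subseteq> G" if "F \<in> lattice" "G \<in> lattice" for F G
    using inj_on_image_subset_iff[OF g(1)] that lattice_subset by blast
  ultimately show ?thesis by (simp add: order_auto_def)
qed

text \<open>
  An order automorphism permutes the atoms \<open>{x}\<close>, and every element of the lattice is the union of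
  the atoms below it.
\<close>

lemma order_auto_vertex_map:
  assumes f: "order_auto lattice f"
  shows "\<exists>g. symmetry V K g \<and> (\<forall>A\<in>lattice. f A = g ` A)"
proof -
  have bij: "bij_betw f lattice lattice"
    and mono: "\<And>A B. A \<in> lattice \<Longrightarrow> B \<in> lattice \<Longrightarrow> f A \<subseteq> f B \<longleftrightarrow> A \<subseteq> B"
    using f by (auto simp: order_auto_def)
  have in_L: "f A \<in> lattice" if "A \<in> lattice" for A using bij that by (rule bij_betw_apply)
  have inj: "A = B" if "f A = f B" "A \<in> lattice" "B \<in> lattice" for A B
    using bij that by (meson bij_betw_def inj_onD)
  have surj: "\<exists>B\<in>lattice. f B = A" if "A \<in> lattice" for A
    using bij that by (metis bij_betw_def imageE)
  have emp: "{} \<in> lattice" and single: "\<And>x. x \<in> V \<Longrightarrow> {x} \<in> lattice"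
    using empty_in_K singleton_in_K by (auto simp: lattice_def)
  have f_empty: "f {} = {}" using surj[OF emp] mono emp by blast
  have "\<exists>y. f {x} = {y}" if x: "x \<in> V" for x
  proof -
    have "f {x} \<noteq> {}" using inj[of "{x}" "{}"] f_empty x emp single by auto
    then obtain y where y: "y \<in> f {x}" by blast
    then have "y \<in> V" using in_L[OF single[OF x]] lattice_subset by blast
    then obtain B where B: "B \<in> lattice" "f B = {y}" using surj single by blast
    then have "B \<subseteq> {x}" using mono[of B "{x}"] y single x by auto
    moreover have "B \<noteq> {}" using B f_empty by auto
    ultimately have "B = {x}" by blast
    with B show ?thesis by blast
  qed
  then obtain g where g: "\<And>x. x \<in> V \<Longrightarrow> f {x} = {g x}" by metis
  have gV: "g x \<in> V" if "x \<in> V" for x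
    using in_L[OF single[OF that]] g[OF that] lattice_subset by auto
  have preim: "\<exists>x\<in>V. g x = y" if y: "y \<in> V" for y
  proof -
    obtain B where B: "B \<in> lattice" "f B = {y}" using surj single y by blast
    then have "B \<noteq> {}" using f_empty by auto
    then obtain x where x: "x \<in> B" by blast
    then have xV: "x \<in> V" using B lattice_subset by blast
    then have "f {x} \<subseteq> {y}" using mono[of "{x}" B] B x single by auto
    then show ?thesis using g[OF xV] xV by auto
  qed
  have fg: "f A = g ` A" if A: "A \<in> lattice" for A
  proof -
    have "g x \<in> f A \<longleftrightarrow> x \<in> A" if "x \<in> V" for x
      using mono[of "{x}" A] single that A g by auto
    moreover have "f A \<subseteq> V" "A \<subseteq> V" using in_L[OF A] A lattice_subset by auto
    ultimately show ?thesis using preim by blast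
  qed
  have "inj_on g V"
  proof (rule inj_onI)
    fix x y assume "x \<in> V" "y \<in> V" "g x = g y"
    then show "x = y" using inj[of "{x}" "{y}"] single g by auto
  qed
  then have gbij: "bij_betw g V V" using gV preim by (auto simp: bij_betw_def)
  have "g ` A \<in> K" if "A \<in> K" for A
  proof -
    have "A \<noteq> V" using that V_notin_K by blast
    then have "f A \<noteq> f V" using inj[of A V] that by (auto simp: lattice_def)
    moreover have "f V = V" using fg[of V] gbij by (simp add: lattice_def bij_betw_def)
    ultimately show ?thesis using in_L[of A] fg[of A] that by (auto simp: lattice_def)
  qed
  then show ?thesis using gbij fg by (auto simp: symmetry_def)
qed

lemma symmetry_id:
  assumes g: "symmetry V K g" and v: "frame v" and fixed: "\<And>j. j < n \<Longrightarrow> g (v j) = v j"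
    and x: "x \<in> V"
  shows "g x = x"
proof (rule rigid[OF g _ _ _ x])
  show "v ` {..<n} \<in> K" "card (v ` {..<n}) = n"
    using v frame_segment_in_K frame_segment_card by auto
qed (use fixed in auto)

text \<open>
  The vertex map of the automorphism preserves cardinalities, so it fixes each member of the flag and
  therefore each vertex of the frame.
\<close>

lemma order_auto_fixing_flag:
  assumes f: "order_auto lattice f" and v: "frame v" and flag: "f ` frame_flag v = frame_flag v"
    and A: "A \<in> lattice"
  shows "f A = A"
proof -
  obtain g where g: "symmetry V K g" and fg: "\<And>A. A \<in> lattice \<Longrightarrow> f A = g ` A"
    using order_auto_vertex_map[OF f] by blast
  have inj: "inj_on g V" and gV: "g ` V = V" using g by (auto simp: symmetry_def bij_betw_def)
  have seg: "g ` v ` {..<j} = v ` {..<j}" if j: "j \<le> n" for j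
  proof -
    let ?A = "v ` {..<j}"
    have AK: "?A \<in> K" using v j by (rule frame_segment_in_K)
    then have "g ` ?A \<in> K" using g by (auto simp: symmetry_def)
    moreover have "f ?A \<in> frame_flag v"
    proof -
      have "?A \<in> frame_flag v" using j by (simp add: frame_flag_eq)
      then have "f ?A \<in> f ` frame_flag v" by (rule imageI)
      then show ?thesis unfolding flag .
    qed
    moreover have "f ?A = g ` ?A" using AK fg by (simp add: lattice_def)
    ultimately obtain i where i: "i \<le> n" "g ` ?A = v ` {..<i}"
      using V_notin_K by (auto simp: frame_flag_eq)
    have "card (g ` ?A) = card ?A"
      using inj K_subset[OF AK] by (intro card_image) (rule inj_on_subset)
    then have "i = j" using i j frame_segment_card[OF v] by metis
    with i show ?thesis by simp
  qed
  have "g (v j) = v j" if j: "j < n" for j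
  proof -
    have sub: "v ` {..<Suc j} \<subseteq> V" using frame_segment_in_K[OF v, of "Suc j"] j K_subset by auto
    have "g (v j) \<in> g ` v ` {..<Suc j}" by simp
    then have "g (v j) \<in> v ` {..<Suc j}" using seg[of "Suc j"] j by simp
    moreover have "g (v j) \<notin> v ` {..<j}"
    proof
      assume "g (v j) \<in> v ` {..<j}"
      then have "g (v j) \<in> g ` v ` {..<j}" using seg[of j] j by simp
      then obtain i where i: "i < j" "g (v j) = g (v i)" by auto
      moreover have "v j \<in> V" "v i \<in> V" using sub i by auto
      ultimately have "v j = v i" using inj by (meson inj_onD)
      then show False using frame_inj[OF v j, of i] i j by simp
    qed
    ultimately show ?thesis by (auto simp: lessThan_Suc)
  qed
  then have "g x = x" if "x \<in> V" for x using symmetry_id[OF g v] that by blast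
  then have "g ` A = A" using lattice_subset[OF A] by force
  then show ?thesis using fg[OF A] by simp
qed

end

section \<open>Polytopes whose face lattice is that of a complex\<close>

lemma Aut_carrier_iff:
  "f \<in> carrier (Aut P) \<longleftrightarrow> f \<in> extensional (faces P) \<and> order_auto (faces P) f"
  by (auto simp: Aut_def Bij_def order_auto_def)

lemma Aut_one: "\<one>\<^bsub>Aut P\<^esub> = (\<lambda>F\<in>faces P. F)"
  by (simp add: Aut_def BijGroup_def)

lemma Aut_mult:
  "f \<in> carrier (Aut P) \<Longrightarrow> g \<in> carrier (Aut P) \<Longrightarrow> f \<otimes>\<^bsub>Aut P\<^esub> g = compose (faces P) f g"
  by (auto simp: Aut_def BijGroup_def)

lemma group_Aut: "group (Aut P)"
proof (rule groupI)
  fix f g assume fg: "f \<in> carrier (Aut P)" "g \<in> carrier (Aut P)"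
  then have f: "order_auto (faces P) f" and g: "order_auto (faces P) g"
    by (simp_all add: Aut_carrier_iff)
  have "g F \<in> faces P" if "F \<in> faces P" for F
    using g that by (auto simp: order_auto_def bij_betw_def)
  then show "f \<otimes>\<^bsub>Aut P\<^esub> g \<in> carrier (Aut P)"
    using f g fg by (auto simp: Aut_mult Aut_carrier_iff order_auto_def bij_betw_compose compose_eq)
next
  show "\<one>\<^bsub>Aut P\<^esub> \<in> carrier (Aut P)"
    by (auto simp: Aut_one Aut_carrier_iff order_auto_def bij_betw_def inj_on_def)
next
  fix f g k assume c: "f \<in> carrier (Aut P)" "g \<in> carrier (Aut P)" "k \<in> carrier (Aut P)"
  interpret B: group "BijGroup (faces P)" by (rule group_BijGroup)
  show "f \<otimes>\<^bsub>Aut P\<^esub> g \<otimes>\<^bsub>Aut P\<^esub> k = f \<otimes>\<^bsub>Aut P\<^esub> (g \<otimes>\<^bsub>Aut P\<^esub> k)"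
    using c B.m_assoc[of f g k] by (simp add: Aut_def BijGroup_def)
next
  fix f assume "f \<in> carrier (Aut P)"
  then show "\<one>\<^bsub>Aut P\<^esub> \<otimes>\<^bsub>Aut P\<^esub> f = f"
    using monoid.l_one[OF group.is_monoid[OF group_BijGroup], of f "faces P"] by (simp add: Aut_def BijGroup_def)
next
  fix f assume fc: "f \<in> carrier (Aut P)"
  then have f: "bij_betw f (faces P) (faces P)"
    and mono: "\<And>F G. F \<in> faces P \<Longrightarrow> G \<in> faces P \<Longrightarrow> f F \<subseteq> f G \<longleftrightarrow> F \<subseteq> G"
    by (auto simp: Aut_carrier_iff order_auto_def)
  let ?g = "\<lambda>F\<in>faces P. inv_into (faces P) f F"
  have cancel: "f (inv_into (faces P) f F) = F" "inv_into (faces P) f F \<in> faces P"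
    if "F \<in> faces P" for F
    using f that by (simp_all add: bij_betw_inv_into_right bij_betw_def inv_into_into)
  have "bij_betw ?g (faces P) (faces P)"
    using bij_betw_inv_into[OF f] by (simp cong: bij_betw_cong)
  moreover have "?g F \<subseteq> ?g G \<longleftrightarrow> F \<subseteq> G" if "F \<in> faces P" "G \<in> faces P" for F G
    using mono[OF cancel(2) cancel(2), OF that] that by (simp add: cancel(1))
  ultimately have "?g \<in> carrier (Aut P)" by (simp add: Aut_carrier_iff order_auto_def)
  moreover have "?g \<otimes>\<^bsub>Aut P\<^esub> f = \<one>\<^bsub>Aut P\<^esub>"
    using calculation fc f by (simp add: Aut_mult Aut_one compose_inv_into_id)
  ultimately show "\<exists>g\<in>carrier (Aut P). g \<otimes>\<^bsub>Aut P\<^esub> f = \<one>\<^bsub>Aut P\<^esub>" by blast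
qed

lemma strict_int_chain:
  fixes f :: "nat \<Rightarrow> int"
  assumes step: "\<And>l. l < N \<Longrightarrow> f l < f (Suc l)" and "a \<le> b" "b \<le> N"
  shows "int b - int a \<le> f b - f a"
  using assms(2,3)
proof (induction b rule: dec_induct)
  case (step m)
  then show ?case using assms(1)[of m] by simp
qed simp

text \<open>
  The relations between the generating rotations that the structure of the mixes depends on; \<open>p i\<close> is
  the \<open>i\<close>-th entry of the Schlaefli type.
\<close>

definition rotation_relations ::
    "nat \<Rightarrow> (nat \<Rightarrow> nat) \<Rightarrow> 'a::euclidean_space set \<Rightarrow> 'a set set \<Rightarrow> bool" where
  "rotation_relations n p P \<Phi> \<longleftrightarrow>
    (\<forall>i. 1 \<le> i \<and> i \<le> n - 1 \<longrightarrow> sigma P \<Phi> i \<in> carrier (Aut P) \<and>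
      sigma P \<Phi> i [^]\<^bsub>Aut P\<^esub> p i = \<one>\<^bsub>Aut P\<^esub>) \<and>
    (\<forall>i. 1 \<le> i \<and> i + 1 \<le> n - 1 \<longrightarrow>
      (sigma P \<Phi> i \<otimes>\<^bsub>Aut P\<^esub> sigma P \<Phi> (i + 1)) [^]\<^bsub>Aut P\<^esub> (2::nat) = \<one>\<^bsub>Aut P\<^esub>)"

text \<open>
  Coxeter relations for maps on \<open>V\<close>, numbered from 1 by the level at which they move a flag.
  Commutation is recorded at distance 2 because
  \<open>\<sigma>\<^sub>i \<sigma>\<^sub>i\<^sub>+\<^sub>1 = \<rho>\<^sub>i\<^sub>-\<^sub>1 \<rho>\<^sub>i\<^sub>+\<^sub>1\<close> for involutions \<open>\<rho>\<^sub>i\<close>.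
\<close>

definition involutions_with_relations ::
    "nat \<Rightarrow> (nat \<Rightarrow> nat) \<Rightarrow> 'a set \<Rightarrow> (nat \<Rightarrow> 'a \<Rightarrow> 'a) \<Rightarrow> bool" where
  "involutions_with_relations n q V r \<longleftrightarrow>
    (\<forall>k x. 1 \<le> k \<longrightarrow> k \<le> n \<longrightarrow> x \<in> V \<longrightarrow> r k (r k x) = x) \<and>
    (\<forall>k x. 1 \<le> k \<longrightarrow> k + 2 \<le> n \<longrightarrow> x \<in> V \<longrightarrow> r k (r (k + 2) x) = r (k + 2) (r k x)) \<and>
    (\<forall>k x. 1 \<le> k \<longrightarrow> k + 1 \<le> n \<longrightarrow> x \<in> V \<longrightarrow> ((r k \<circ> r (k + 1)) ^^ q k) x = x)"

lemma funpow_comp_swap: "((g \<circ> f) ^^ m) (g x) = g (((f \<circ> g) ^^ m) x)"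
  by (induction m) auto

context thin_complex
begin

definition reflection :: "(nat \<Rightarrow> 'a) \<Rightarrow> nat \<Rightarrow> ('a \<Rightarrow> 'a) \<Rightarrow> bool" where
  "reflection v k g \<longleftrightarrow> symmetry V K g \<and>
    (\<forall>l. 1 \<le> l \<and> l \<le> n \<longrightarrow> (flag_elem v l = flag_elem (g \<circ> v) l \<longleftrightarrow> l \<noteq> k))"

lemma symmetry_comp: "symmetry V K g \<Longrightarrow> symmetry V K g' \<Longrightarrow> symmetry V K (g \<circ> g')"
  unfolding symmetry_def image_comp [symmetric] by (blast intro: bij_betw_trans)

lemma symmetry_funpow: "symmetry V K g \<Longrightarrow> symmetry V K (g ^^ m)"
  by (induction m) (auto simp: symmetry_comp, auto simp: symmetry_def)

lemma symmetry_in_V: "symmetry V K g \<Longrightarrow> x \<in> V \<Longrightarrow> g x \<in> V"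
  by (auto simp: symmetry_def bij_betw_def)

lemma symmetry_lattice: "symmetry V K g \<Longrightarrow> A \<in> lattice \<Longrightarrow> g ` A \<in> lattice"
  by (auto simp: symmetry_def lattice_def bij_betw_def)

lemma symmetry_flag_elem: "symmetry V K g \<Longrightarrow> g ` flag_elem v l = flag_elem (g \<circ> v) l"
  by (auto simp: symmetry_def flag_elem_def bij_betw_def image_comp)

lemma symmetry_frame:
  assumes g: "symmetry V K g" and v: "frame v" shows "frame (g \<circ> v)"
proof -
  have "v ` {..<n} \<subseteq> V" using v K_subset by (simp add: frame_def)
  then have "inj_on (g \<circ> v) {..<n}"
    using g v by (intro comp_inj_on) (auto simp: frame_def symmetry_def bij_betw_def intro: inj_on_subset)
  then show ?thesis
    using g v unfolding frame_def symmetry_def image_comp [symmetric] by blast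
qed

end

text \<open>
  An identification \<open>h\<close> of the lattice of a complex with the face lattice of a polytope, preserving or
  reversing the order. The reversing case serves the cube, which is dual to the cross-polytope: there
  a set of vertices of the complex stands for the intersection of the corresponding facets.
\<close>

locale face_representation = thin_complex V K n
  for V :: "'v set" and K :: "'v set set" and n :: nat +
  fixes P :: "'a::euclidean_space set" and h :: "'v set \<Rightarrow> 'a set" and reversed :: bool
  assumes dim: "n = DIM('a)"
    and bij: "bij_betw h lattice (faces P)"
    and order: "A \<in> lattice \<Longrightarrow> B \<in> lattice \<Longrightarrow> h A \<subseteq> h B \<longleftrightarrow> (if reversed then B \<subseteq> A else A \<subseteq> B)"
begin

text \<open>
  The level of the faces of dimension \<open>i\<close>, for \<open>i \<le> n\<close>.
\<close>

definition level :: "nat \<Rightarrow> nat" where "level i = (if reversed then n - i else i + 1)"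

lemma h_eq_iff: "A \<in> lattice \<Longrightarrow> B \<in> lattice \<Longrightarrow> h A = h B \<longleftrightarrow> A = B"
  using bij by (meson bij_betw_def inj_on_eq_iff)

lemma h_face: "A \<in> lattice \<Longrightarrow> h A \<in> faces P"
  using bij by (rule bij_betw_apply)

lemma h_surj: "F \<in> faces P \<Longrightarrow> \<exists>A\<in>lattice. F = h A"
  using bij by (metis bij_betw_def imageE)

lemma comparable_iff:
  "A \<in> lattice \<Longrightarrow> B \<in> lattice \<Longrightarrow> (h A \<subseteq> h B \<or> h B \<subseteq> h A) \<longleftrightarrow> (A \<subseteq> B \<or> B \<subseteq> A)"
  using order by (cases reversed) auto

lemma maxchain_image:
  assumes C: "C \<subseteq> lattice"
  shows "subset.maxchain (faces P) (h ` C) \<longleftrightarrow> subset.maxchain lattice C"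
proof -
  have "h ` C \<subseteq> faces P" using C h_face by blast
  moreover have "(\<forall>D\<in>h ` C. \<forall>Y\<in>h ` C. D \<subseteq> Y \<or> Y \<subseteq> D) \<longleftrightarrow> (\<forall>D\<in>C. \<forall>Y\<in>C. D \<subseteq> Y \<or> Y \<subseteq> D)"
    using comparable_iff C by (auto simp: subset_iff)
  moreover have "((\<forall>D\<in>h ` C. D \<subseteq> h Z \<or> h Z \<subseteq> D) \<longrightarrow> h Z \<in> h ` C) \<longleftrightarrow>
      ((\<forall>D\<in>C. D \<subseteq> Z \<or> Z \<subseteq> D) \<longrightarrow> Z \<in> C)" if Z: "Z \<in> lattice" for Z
  proof -
    have "(\<forall>D\<in>h ` C. D \<subseteq> h Z \<or> h Z \<subseteq> D) \<longleftrightarrow> (\<forall>D\<in>C. D \<subseteq> Z \<or> Z \<subseteq> D)"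
      using comparable_iff[OF _ Z] C by (simp add: subset_iff)
    moreover have "h Z \<in> h ` C \<longleftrightarrow> Z \<in> C"
      using h_eq_iff[OF Z] C by (auto simp: subset_iff)
    ultimately show ?thesis by simp
  qed
  moreover have "faces P = h ` lattice" using bij by (simp add: bij_betw_def)
  ultimately show ?thesis unfolding maxchain_iff using C by simp
qed

lemma flag_iff: "flag P \<Phi> \<longleftrightarrow> (\<exists>v. frame v \<and> \<Phi> = h ` frame_flag v)"
proof
  assume "flag P \<Phi>"
  then have mx: "subset.maxchain (faces P) \<Phi>" by (simp add: flag_def)
  then have "\<Phi> \<subseteq> h ` lattice" using bij by (simp add: maxchain_iff bij_betw_def)
  then obtain C where "C \<subseteq> lattice" "\<Phi> = h ` C" by (meson subset_imageE)
  then show "\<exists>v. frame v \<and> \<Phi> = h ` frame_flag v"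
    using mx maxchain_image maxchain_imp_frame_flag by blast
next
  assume "\<exists>v. frame v \<and> \<Phi> = h ` frame_flag v"
  then obtain v where v: "frame v" "\<Phi> = h ` frame_flag v" by blast
  then have "frame_flag v \<subseteq> lattice" using flag_elem_in_lattice by (auto simp: frame_flag_def)
  then show "flag P \<Phi>" using v maxchain_frame_flag maxchain_image by (simp add: flag_def)
qed

text \<open>
  The \<open>n + 2\<close> members of a flag have strictly monotone dimensions between \<open>-1\<close> and \<open>n\<close>, and this
  leaves only one possibility for each of them.
\<close>

lemma aff_dim_flag_elem:
  assumes v: "frame v" and l: "l \<le> Suc n"
  shows "aff_dim (h (flag_elem v l)) = (if reversed then int n - int l else int l - 1)"
proof -
  let ?d = "\<lambda>l. aff_dim (h (flag_elem v l))"
  have bounds: "-1 \<le> ?d m" "?d m \<le> int n" for m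
    by (simp_all add: aff_dim_geq aff_dim_le_DIM dim)
  have dim_less: "aff_dim (h A) < aff_dim (h B)"
    if "A \<in> lattice" "B \<in> lattice" "h A \<subseteq> h B" "A \<noteq> B" for A B
  proof (rule face_of_aff_dim_lt)
    have "h A face_of P" "h B face_of P" using h_face that by (auto simp: faces_def)
    then show "h A face_of h B" "convex (h B)"
      using that(3) face_of_subset face_of_imp_subset face_of_imp_convex by metis+
    show "h A \<noteq> h B" using that h_eq_iff by blast
  qed
  have step: "(if reversed then ?d (Suc m) < ?d m else ?d m < ?d (Suc m))" if m: "m < Suc n" for m
  proof -
    have "flag_elem v m \<subseteq> flag_elem v (Suc m)" "flag_elem v m \<noteq> flag_elem v (Suc m)"
      using flag_elem_mono[OF v, of m "Suc m"] flag_elem_inj[OF v, of m "Suc m"] m by auto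
    then show ?thesis using dim_less flag_elem_in_lattice[OF v] order by auto
  qed
  show ?thesis
  proof (cases reversed)
    case False
    then have "?d m < ?d (Suc m)" if "m < Suc n" for m using step[OF that] by simp
    from strict_int_chain[of "Suc n" ?d, OF this, of 0 l] strict_int_chain[of "Suc n" ?d, OF this, of l "Suc n"]
    show ?thesis using l bounds[of 0] bounds[of "Suc n"] False by simp
  next
    case True
    then have "- ?d m < - ?d (Suc m)" if "m < Suc n" for m using step[OF that] by simp
    from strict_int_chain[of "Suc n" "\<lambda>m. - ?d m", OF this, of 0 l]
      strict_int_chain[of "Suc n" "\<lambda>m. - ?d m", OF this, of l "Suc n"]
    show ?thesis using l bounds[of 0] bounds[of "Suc n"] True by simp
  qed
qed

lemma faces_of_flag_of_dim:
  assumes v: "frame v"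
  shows "{F \<in> h ` frame_flag v. aff_dim F = int j} = (if j \<le> n then {h (flag_elem v (level j))} else {})"
proof -
  have "aff_dim (h (flag_elem v l)) = int j \<longleftrightarrow> j \<le> n \<and> l = level j" if "l \<le> Suc n" for l
    using aff_dim_flag_elem[OF v that] that by (auto simp: level_def)
  moreover have "level j \<le> Suc n" if "j \<le> n" using that by (auto simp: level_def)
  ultimately show ?thesis by (auto simp: frame_flag_def)
qed

lemma differ_exactly_in_iff:
  assumes v: "frame v" and w: "frame w" and i: "i < n"
  shows "differ_exactly_in i (h ` frame_flag v) (h ` frame_flag w) \<longleftrightarrow>
    (\<forall>l. 1 \<le> l \<and> l \<le> n \<longrightarrow> (flag_elem v l = flag_elem w l \<longleftrightarrow> l \<noteq> level i))"
proof -
  have eq: "h (flag_elem v l) = h (flag_elem w l) \<longleftrightarrow> flag_elem v l = flag_elem w l" for l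
    using h_eq_iff flag_elem_in_lattice v w by blast
  have "differ_exactly_in i (h ` frame_flag v) (h ` frame_flag w) \<longleftrightarrow>
      (\<forall>j\<le>n. flag_elem v (level j) = flag_elem w (level j) \<longleftrightarrow> j \<noteq> i)"
    using i by (auto simp: differ_exactly_in_def faces_of_flag_of_dim v w eq)
  also have "\<dots> \<longleftrightarrow> (\<forall>j<n. flag_elem v (level j) = flag_elem w (level j) \<longleftrightarrow> j \<noteq> i)"
  proof -
    have "flag_elem v (level n) = flag_elem w (level n)" by (simp add: level_def flag_elem_def)
    then show ?thesis using i by (metis le_eq_less_or_eq less_irrefl)
  qed
  also have "\<dots> \<longleftrightarrow> (\<forall>l. 1 \<le> l \<and> l \<le> n \<longrightarrow> (flag_elem v l = flag_elem w l \<longleftrightarrow> l \<noteq> level i))"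
  proof -
    have surj: "\<exists>j<n. l = level j" if "1 \<le> l" "l \<le> n" for l
      using that by (intro exI[of _ "if reversed then n - l else l - 1"]) (auto simp: level_def)
    have rng: "1 \<le> level j \<and> level j \<le> n" if "j < n" for j using that by (auto simp: level_def)
    have inj: "level j = level i \<longleftrightarrow> j = i" if "j < n" for j using that i by (auto simp: level_def)
    show ?thesis
    proof (rule iffI; intro allI impI)
      fix l assume all: "\<forall>j<n. flag_elem v (level j) = flag_elem w (level j) \<longleftrightarrow> j \<noteq> i" and l: "1 \<le> l \<and> l \<le> n"
      obtain j where j: "j < n" "l = level j" using surj l by blast
      then show "flag_elem v l = flag_elem w l \<longleftrightarrow> l \<noteq> level i" using all inj by simp
    next
      fix j assume "\<forall>l. 1 \<le> l \<and> l \<le> n \<longrightarrow> (flag_elem v l = flag_elem w l \<longleftrightarrow> l \<noteq> level i)" and j: "j < n"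
      then have "flag_elem v (level j) = flag_elem w (level j) \<longleftrightarrow> level j \<noteq> level i" using rng[OF j] by blast
      then show "flag_elem v (level j) = flag_elem w (level j) \<longleftrightarrow> j \<noteq> i" using inj[OF j] by simp
    qed
  qed
  finally show ?thesis .
qed

definition induced :: "('v \<Rightarrow> 'v) \<Rightarrow> 'a set \<Rightarrow> 'a set" where
  "induced g = (\<lambda>F\<in>faces P. h (g ` inv_into lattice h F))"

lemma induced_h: "A \<in> lattice \<Longrightarrow> induced g (h A) = h (g ` A)"
  using bij by (simp add: induced_def h_face bij_betw_inv_into_left)

lemma induced_in_Aut:
  assumes g: "symmetry V K g" shows "induced g \<in> carrier (Aut P)"
proof -
  note auto = symmetry_order_auto[OF g, unfolded order_auto_def]
  have "bij_betw (h \<circ> (`) g \<circ> inv_into lattice h) (faces P) (faces P)"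
    using bij_betw_inv_into[OF bij] auto bij by (auto intro!: bij_betw_trans)
  then have "bij_betw (induced g) (faces P) (faces P)"
    by (simp add: induced_def cong: bij_betw_cong)
  moreover have "induced g F \<subseteq> induced g G \<longleftrightarrow> F \<subseteq> G" if FG: "F \<in> faces P" "G \<in> faces P" for F G
  proof -
    obtain A B where AB: "A \<in> lattice" "B \<in> lattice" "F = h A" "G = h B" using h_surj FG by metis
    then show ?thesis
      using auto symmetry_lattice[OF g] by (simp add: induced_h order)
  qed
  ultimately show ?thesis by (auto simp: Aut_carrier_iff order_auto_def induced_def)
qed

lemma induced_comp:
  assumes "symmetry V K g" "symmetry V K g'"
  shows "induced g \<otimes>\<^bsub>Aut P\<^esub> induced g' = induced (g \<circ> g')"
proof -
  have "compose (faces P) (induced g) (induced g') F = induced (g \<circ> g') F" for F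
  proof (cases "F \<in> faces P")
    case True
    then obtain A where "A \<in> lattice" "F = h A" using h_surj by blast
    then show ?thesis
      using True symmetry_lattice[OF assms(2)] by (simp add: compose_eq induced_h image_comp)
  qed (simp add: compose_def induced_def)
  then show ?thesis using induced_in_Aut assms by (auto simp: Aut_mult)
qed

lemma induced_id:
  assumes "\<And>x. x \<in> V \<Longrightarrow> g x = x" shows "induced g = \<one>\<^bsub>Aut P\<^esub>"
proof -
  have "induced g F = (\<lambda>F\<in>faces P. F) F" for F
  proof (cases "F \<in> faces P")
    case True
    then obtain A where A: "A \<in> lattice" "F = h A" using h_surj by blast
    then have "g ` A = A" using lattice_subset assms by force
    then show ?thesis using A True by (simp add: induced_h)
  qed (simp add: induced_def)
  then show ?thesis by (auto simp: Aut_one)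
qed

lemma induced_pow:
  assumes g: "symmetry V K g" shows "induced g [^]\<^bsub>Aut P\<^esub> (m::nat) = induced (g ^^ m)"
proof (induction m)
  case 0
  have "induced (g ^^ 0) = \<one>\<^bsub>Aut P\<^esub>" by (rule induced_id) simp
  then show ?case by (simp only: nat_pow_0)
next
  case (Suc m)
  have "induced g [^]\<^bsub>Aut P\<^esub> Suc m = induced g [^]\<^bsub>Aut P\<^esub> m \<otimes>\<^bsub>Aut P\<^esub> induced g"
    by (rule nat_pow_Suc)
  also have "\<dots> = induced (g ^^ m \<circ> g)" using Suc induced_comp symmetry_funpow g by metis
  finally show ?case by (simp only: funpow_Suc_right)
qed

text \<open>
  The automorphism is transported along \<open>h\<close> to the lattice of the complex, where it comes from a
  permutation of the vertices.
\<close>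

lemma Aut_fixing_flag:
  assumes f: "f \<in> carrier (Aut P)" and v: "frame v"
    and flag: "f ` h ` frame_flag v = h ` frame_flag v"
  shows "f = \<one>\<^bsub>Aut P\<^esub>"
proof -
  have fP: "bij_betw f (faces P) (faces P)" "f \<in> extensional (faces P)"
    and mono: "\<And>F G. F \<in> faces P \<Longrightarrow> G \<in> faces P \<Longrightarrow> f F \<subseteq> f G \<longleftrightarrow> F \<subseteq> G"
    using f by (auto simp: Aut_carrier_iff order_auto_def)
  define k where "k = inv_into lattice h \<circ> f \<circ> h"
  have hk: "h (k A) = f (h A)" "k A \<in> lattice" if "A \<in> lattice" for A
  proof -
    have "f (h A) \<in> faces P" using fP h_face that by (auto simp: bij_betw_def)
    then show "h (k A) = f (h A)" "k A \<in> lattice"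
      using bij by (simp_all add: k_def bij_betw_inv_into_right bij_betw_def inv_into_into)
  qed
  have "bij_betw k lattice lattice"
    unfolding k_def
    using bij_betw_trans[OF bij_betw_trans[OF bij fP(1)] bij_betw_inv_into[OF bij]] by (simp add: comp_assoc)
  moreover have "k A \<subseteq> k B \<longleftrightarrow> A \<subseteq> B" if AB: "A \<in> lattice" "B \<in> lattice" for A B
  proof -
    have "h (k A) \<subseteq> h (k B) \<longleftrightarrow> h A \<subseteq> h B" "h (k B) \<subseteq> h (k A) \<longleftrightarrow> h B \<subseteq> h A"
      using hk AB mono h_face by simp_all
    then show ?thesis using order[OF hk(2) hk(2)] order AB by (metis (full_types))
  qed
  ultimately have auto: "order_auto lattice k" by (simp add: order_auto_def)
  have sub: "frame_flag v \<subseteq> lattice" using flag_elem_in_lattice[OF v] by (auto simp: frame_flag_def)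
  have "k ` frame_flag v = inv_into lattice h ` (f ` h ` frame_flag v)" by (simp add: k_def image_comp)
  also have "\<dots> = frame_flag v"
    unfolding flag using bij sub by (simp add: bij_betw_def inv_into_image_cancel)
  finally have "k A = A" if "A \<in> lattice" for A
    using order_auto_fixing_flag[OF auto v] that by blast
  then have "f (h A) = h A" if "A \<in> lattice" for A using hk that by metis
  then have "f F = F" if "F \<in> faces P" for F using h_surj that by blast
  then show ?thesis using fP(2) by (auto simp: Aut_one fun_eq_iff extensional_def)
qed

lemma Aut_eqI:
  assumes f: "f \<in> carrier (Aut P)" and g: "g \<in> carrier (Aut P)" and v: "frame v"
    and eq: "f ` h ` frame_flag v = g ` h ` frame_flag v"
  shows "f = g"
proof -
  interpret A: group "Aut P" by (rule group_Aut)
  have sub: "h ` frame_flag v \<subseteq> faces P"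
    using flag_elem_in_lattice[OF v] h_face by (auto simp: frame_flag_def)
  have image_mult: "(k \<otimes>\<^bsub>Aut P\<^esub> k') ` h ` frame_flag v = k ` k' ` h ` frame_flag v"
    if "k \<in> carrier (Aut P)" "k' \<in> carrier (Aut P)" for k k'
    using that sub by (force simp: Aut_mult compose_eq image_iff)
  have "(inv\<^bsub>Aut P\<^esub> g \<otimes>\<^bsub>Aut P\<^esub> f) ` h ` frame_flag v = (inv\<^bsub>Aut P\<^esub> g \<otimes>\<^bsub>Aut P\<^esub> g) ` h ` frame_flag v"
    by (simp only: image_mult[OF A.inv_closed[OF g] f] image_mult[OF A.inv_closed[OF g] g] eq)
  also have "\<dots> = h ` frame_flag v" unfolding A.l_inv[OF g] Aut_one using sub by (force simp: image_iff subset_iff)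
  finally have "inv\<^bsub>Aut P\<^esub> g \<otimes>\<^bsub>Aut P\<^esub> f = \<one>\<^bsub>Aut P\<^esub>"
    using f g by (intro Aut_fixing_flag[OF _ v]) auto
  then show ?thesis using f g by (metis A.inv_closed A.inv_equality A.inv_inv)
qed

lemma adjacent_flag_eq:
  assumes v: "frame v" and i: "i < n" and g: "reflection v (level i) g"
  shows "adjacent_flag P (h ` frame_flag v) i = h ` frame_flag (g \<circ> v)"
  unfolding adjacent_flag_def
proof (rule the_equality)
  have sym: "symmetry V K g"
    and refl: "\<And>l. 1 \<le> l \<Longrightarrow> l \<le> n \<Longrightarrow> flag_elem v l = flag_elem (g \<circ> v) l \<longleftrightarrow> l \<noteq> level i"
    using g by (auto simp: reflection_def)
  have gv: "frame (g \<circ> v)" using symmetry_frame[OF sym v] .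
  show "flag P (h ` frame_flag (g \<circ> v)) \<and> differ_exactly_in i (h ` frame_flag v) (h ` frame_flag (g \<circ> v))"
    using gv refl flag_iff differ_exactly_in_iff[OF v gv i] by blast
  fix \<Psi> assume \<Psi>': "flag P \<Psi> \<and> differ_exactly_in i (h ` frame_flag v) \<Psi>"
  then obtain w where w: "frame w" and \<Psi>: "\<Psi> = h ` frame_flag w"
    unfolding flag_iff by blast
  have "differ_exactly_in i (h ` frame_flag v) (h ` frame_flag w)" using \<Psi>' \<Psi> by blast
  then have diff: "\<And>l. 1 \<le> l \<Longrightarrow> l \<le> n \<Longrightarrow> flag_elem v l = flag_elem w l \<longleftrightarrow> l \<noteq> level i"
    using differ_exactly_in_iff[OF v w i] by blast
  have level: "1 \<le> level i" "level i \<le> n" using i by (auto simp: level_def)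
  have "flag_elem w (level i) = flag_elem (g \<circ> v) (level i)"
    using adjacent_frame_unique[OF v w gv level] diff refl level by metis
  then have "flag_elem w l = flag_elem (g \<circ> v) l" if "1 \<le> l" "l \<le> n" for l
    using diff refl that by metis
  then have "flag_elem w l = flag_elem (g \<circ> v) l" for l
    by (cases "1 \<le> l \<and> l \<le> n") (auto simp: flag_elem_def)
  then show "\<Psi> = h ` frame_flag (g \<circ> v)" by (simp add: \<Psi> frame_flag_def)
qed

text \<open>
  Automorphisms are determined by their action on one flag, so \<open>rho\<close> is induced by any vertex symmetry
  that moves the base flag to the adjacent one.
\<close>

lemma rho_eq:
  assumes v: "frame v" and i: "i < n" and g: "reflection v (level i) g"
  shows "rho P (h ` frame_flag v) i = induced g"
  unfolding rho_def adjacent_flag_eq[OF assms]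
proof (rule the_equality)
  have sym: "symmetry V K g" using g by (simp add: reflection_def)
  have "induced g (h (flag_elem v l)) = h (flag_elem (g \<circ> v) l)" for l
    using sym symmetry_flag_elem by (simp add: induced_h flag_elem_in_lattice v)
  then have img: "induced g ` h ` frame_flag v = h ` frame_flag (g \<circ> v)"
    by (simp add: frame_flag_def image_image)
  then show "induced g \<in> carrier (Aut P) \<and> induced g ` h ` frame_flag v = h ` frame_flag (g \<circ> v)"
    using induced_in_Aut sym by blast
  fix f assume "f \<in> carrier (Aut P) \<and> f ` h ` frame_flag v = h ` frame_flag (g \<circ> v)"
  then show "f = induced g" using Aut_eqI[OF _ induced_in_Aut[OF sym] v] img by metis
qed

text \<open>
  If the order is reversed, the levels descend while \<open>i\<close> grows: then \<open>\<sigma>\<^sub>i\<close> is induced by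
  \<open>r (k + 1) \<circ> r k\<close> with \<open>k = n - i\<close>, and the exponents appear in reversed order.
\<close>

lemma rotation_relations:
  assumes v: "frame v" and refl: "\<And>k. 1 \<le> k \<Longrightarrow> k \<le> n \<Longrightarrow> reflection v k (r k)"
    and rel: "involutions_with_relations n q V r"
  shows "rotation_relations n (\<lambda>i. q (if reversed then n - i else i)) P (h ` frame_flag v)"
proof -
  have sym: "symmetry V K (r k)" if "1 \<le> k" "k \<le> n" for k
    using refl that by (auto simp: reflection_def)
  have inV: "r k x \<in> V" if "1 \<le> k" "k \<le> n" "x \<in> V" for k x
    using sym symmetry_in_V that by blast
  have square: "r k (r k x) = x" if "1 \<le> k" "k \<le> n" "x \<in> V" for k x
    using rel that by (simp add: involutions_with_relations_def)
  have commute: "r k (r (k + 2) x) = r (k + 2) (r k x)" if "1 \<le> k" "k + 2 \<le> n" "x \<in> V" for k x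
    using rel that by (simp add: involutions_with_relations_def)
  have up: "((r k \<circ> r (k + 1)) ^^ q k) x = x" if "1 \<le> k" "k + 1 \<le> n" "x \<in> V" for k x
    using rel that by (simp add: involutions_with_relations_def)
  have down: "((r (k + 1) \<circ> r k) ^^ q k) x = x" if k: "1 \<le> k" "k + 1 \<le> n" and x: "x \<in> V" for k x
  proof -
    have "((r (k + 1) \<circ> r k) ^^ q k) (r (k + 1) (r (k + 1) x)) = r (k + 1) (r (k + 1) x)"
      using up[OF k, of "r (k + 1) x"] inV[of "k + 1" x] k x by (simp only: funpow_comp_swap)
    then show ?thesis using square[of "k + 1" x] k x by simp
  qed
  have sigma: "sigma P (h ` frame_flag v) i = induced (r (level (i - 1)) \<circ> r (level i)) \<and>
      symmetry V K (r (level (i - 1)) \<circ> r (level i))" if i: "1 \<le> i" "i \<le> n - 1" for i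
  proof -
    have "1 \<le> level (i - 1)" "level (i - 1) \<le> n" "1 \<le> level i" "level i \<le> n"
      using i by (auto simp: level_def)
    moreover have "i - 1 < n" "i < n" using i by auto
    ultimately show ?thesis
      using rho_eq[OF v _ refl] sym by (simp add: sigma_def induced_comp symmetry_comp)
  qed
  show ?thesis
    unfolding rotation_relations_def
  proof (intro conjI allI impI)
    fix i assume i: "1 \<le> i \<and> i \<le> n - 1"
    show "sigma P (h ` frame_flag v) i \<in> carrier (Aut P)"
      using sigma[of i] i induced_in_Aut by simp
    have "((r (level (i - 1)) \<circ> r (level i)) ^^ q (if reversed then n - i else i)) x = x" if x: "x \<in> V" for x
    proof (cases reversed)
      case True
      then have "level (i - 1) = n - i + 1" "level i = n - i" unfolding level_def using i by auto
      moreover have "1 \<le> n - i" "n - i + 1 \<le> n" using i by linarith+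
      ultimately show ?thesis using down[of "n - i" x] x True by simp
    next
      case False
      then have "level (i - 1) = i" "level i = i + 1" unfolding level_def using i by auto
      moreover have "1 \<le> i" "i + 1 \<le> n" using i by linarith+
      ultimately show ?thesis using up[of i x] x False by simp
    qed
    then show "sigma P (h ` frame_flag v) i [^]\<^bsub>Aut P\<^esub> q (if reversed then n - i else i) = \<one>\<^bsub>Aut P\<^esub>"
      using sigma[of i] i induced_pow induced_id by metis
  next
    fix i assume i: "1 \<le> i \<and> i + 1 \<le> n - 1"
    define a b c where "a = level (i - 1)" and "b = level i" and "c = level (i + 1)"
    have rng: "1 \<le> a" "a \<le> n" "1 \<le> b" "b \<le> n" "1 \<le> c" "c \<le> n"
      using i by (auto simp: a_def b_def c_def level_def)
    have ac: "r a (r c x) = r c (r a x)" if "x \<in> V" for x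
    proof (cases reversed)
      case True
      then have "a = c + 2" unfolding a_def c_def level_def using i by auto
      then show ?thesis using commute[of c x] rng that by simp
    next
      case False
      then have "c = a + 2" unfolding a_def c_def level_def using i by auto
      then show ?thesis using commute[of a x] rng that by simp
    qed
    define g where "g = r a \<circ> r b \<circ> (r b \<circ> r c)"
    have g: "g x = r a (r c x)" if "x \<in> V" for x
      using that rng inV square by (simp add: g_def)
    have "(g ^^ 2) x = x" if x: "x \<in> V" for x
    proof -
      have "(g ^^ 2) x = g (g x)" by (simp add: numeral_2_eq_2)
      also have "\<dots> = r a (r c (r a (r c x)))" using x rng inV g by simp
      also have "\<dots> = x" using x rng inV square ac by simp
      finally show ?thesis .
    qed
    then have "induced (g ^^ 2) = \<one>\<^bsub>Aut P\<^esub>" by (rule induced_id)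
    moreover have "symmetry V K g" unfolding g_def using rng by (intro symmetry_comp sym)
    moreover have "sigma P (h ` frame_flag v) i \<otimes>\<^bsub>Aut P\<^esub> sigma P (h ` frame_flag v) (i + 1) = induced g"
      using sigma[of i] sigma[of "i + 1"] i induced_comp by (simp add: a_def b_def c_def g_def)
    ultimately show "(sigma P (h ` frame_flag v) i \<otimes>\<^bsub>Aut P\<^esub> sigma P (h ` frame_flag v) (i + 1))
        [^]\<^bsub>Aut P\<^esub> (2::nat) = \<one>\<^bsub>Aut P\<^esub>"
      by (simp only: induced_pow)
  qed
qed

end

section \<open>The boundary complex of a simplex\<close>

abbreviation adj_swap :: "nat \<Rightarrow> nat \<Rightarrow> nat" where
  "adj_swap k \<equiv> Transposition.transpose (k - 1) k"

lemma adj_swap_initial_segment: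
  assumes "1 \<le> k" shows "{..<l} = adj_swap k ` {..<l} \<longleftrightarrow> l \<noteq> k"
proof (cases "l = k")
  case True
  then have "k - 1 \<in> {..<l}" using assms by simp
  then have "k \<in> adj_swap k ` {..<l}" by (metis imageI transpose_apply_first)
  then show ?thesis using True by auto
next
  case False
  then have "k - 1 \<in> {..<l} \<longleftrightarrow> k \<in> {..<l}" by auto
  then have "adj_swap k ` {..<l} = {..<l}" by (rule transpose_image_eq)
  then show ?thesis using False by simp
qed

lemma adj_swap_commute: "1 \<le> k \<Longrightarrow> adj_swap k (adj_swap (k + 2) j) = adj_swap (k + 2) (adj_swap k j)"
  by (auto simp: Transposition.transpose_def)

lemma adj_swap_braid: "1 \<le> k \<Longrightarrow> ((adj_swap k \<circ> adj_swap (k + 1)) ^^ 3) j = j"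
  by (auto simp: Transposition.transpose_def numeral_3_eq_3)

lemma funpow_transfer:
  assumes "\<And>y. y \<in> D \<Longrightarrow> f (w y) = w (g y)" "\<And>y. y \<in> D \<Longrightarrow> g y \<in> D" "y \<in> D"
  shows "(f ^^ m) (w y) = w ((g ^^ m) y) \<and> (g ^^ m) y \<in> D"
  by (induction m) (use assms in auto)

text \<open>
  It suffices to check the relations in coordinates: \<open>w\<close> parametrises the vertices by numbers, or by
  numbers with signs, on which the reflections act by the explicit maps \<open>s k\<close>.
\<close>

lemma involutions_with_relations_transfer:
  assumes V: "V = w ` D"
    and conj: "\<And>k y. 1 \<le> k \<Longrightarrow> k \<le> n \<Longrightarrow> y \<in> D \<Longrightarrow> r k (w y) = w (s k y)"
    and closed: "\<And>k y. 1 \<le> k \<Longrightarrow> k \<le> n \<Longrightarrow> y \<in> D \<Longrightarrow> s k y \<in> D"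
    and s: "involutions_with_relations n q D s"
  shows "involutions_with_relations n q V r"
  unfolding involutions_with_relations_def
proof (intro conjI allI impI)
  fix k x assume k: "1 \<le> k" "k \<le> n" and "x \<in> V"
  then obtain y where y: "y \<in> D" "x = w y" using V by blast
  then show "r k (r k x) = x"
    using s k conj closed by (simp add: involutions_with_relations_def)
next
  fix k x assume k: "1 \<le> k" "k + 2 \<le> n" and "x \<in> V"
  then obtain y where y: "y \<in> D" "x = w y" using V by blast
  have "s k (s (k + 2) y) = s (k + 2) (s k y)" using s k y by (simp add: involutions_with_relations_def)
  then show "r k (r (k + 2) x) = r (k + 2) (r k x)"
    using conj[of k] conj[of "k + 2"] closed[of k] closed[of "k + 2"] k y by simp
next
  fix k x assume k: "1 \<le> k" "k + 1 \<le> n" and "x \<in> V"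
  then obtain y where y: "y \<in> D" "x = w y" using V by blast
  have "((r k \<circ> r (k + 1)) ^^ q k) (w y) = w (((s k \<circ> s (k + 1)) ^^ q k) y)"
    using funpow_transfer[of D "r k \<circ> r (k + 1)" w "s k \<circ> s (k + 1)" y "q k"] conj closed k y by simp
  also have "\<dots> = w y" using s k y by (simp add: involutions_with_relations_def)
  finally show "((r k \<circ> r (k + 1)) ^^ q k) x = x" using y by simp
qed

definition proper_subsets :: "'a set \<Rightarrow> 'a set set" where "proper_subsets V = {A. A \<subset> V}"

locale simplex_complex =
  fixes V :: "'a set" and n :: nat
  assumes card_V: "card V = Suc n" and n_pos: "1 \<le> n"
begin

lemma fin_V: "finite V" using card_V by (simp add: card_ge_0_finite)

lemma card_proper: "A \<subset> V \<Longrightarrow> card A \<le> n"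
  using psubset_card_mono[OF fin_V, of A] card_V by simp

sublocale thin_complex V "proper_subsets V" n
proof
  show "{x} \<in> proper_subsets V" if "x \<in> V" for x
    using that card_V n_pos by (auto simp: proper_subsets_def card_insert_if)
  show "{} \<in> proper_subsets V" using card_V by (auto simp: proper_subsets_def)
  show "\<exists>x. x \<notin> A \<and> insert x A \<in> proper_subsets V" if A: "A \<in> proper_subsets V" "card A < n" for A
  proof -
    obtain x where x: "x \<in> V" "x \<notin> A" using A by (auto simp: proper_subsets_def)
    have "card (insert x A) < card V"
      using A card_V x fin_V finite_subset[of A V] by (auto simp: proper_subsets_def)
    then show ?thesis using A x by (auto simp: proper_subsets_def)
  qed
  show "x = y \<or> x = z \<or> y = z"
    if R: "card R = n - 1" "x \<notin> R" "y \<notin> R" "z \<notin> R" and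
      "insert x R \<in> proper_subsets V" "insert y R \<in> proper_subsets V" "insert z R \<in> proper_subsets V" for R x y z
  proof (rule ccontr)
    assume ne: "\<not> ?thesis"
    have sub: "insert x (insert y (insert z R)) \<subseteq> V" using that by (auto simp: proper_subsets_def)
    then have "finite R" by (intro finite_subset[OF _ fin_V]) simp
    then have "card (insert x (insert y (insert z R))) = n + 2" using R ne n_pos by simp
    then show False using card_mono[OF fin_V sub] card_V by simp
  qed
  show "g x = x"
    if g: "symmetry V (proper_subsets V) g" and A: "A \<in> proper_subsets V" "card A = n"
      and fixed: "\<And>x. x \<in> A \<Longrightarrow> g x = x" and x: "x \<in> V" for g A x
  proof (cases "x \<in> A")
    case False
    have sub: "insert x A \<subseteq> V" using A x by (auto simp: proper_subsets_def)
    moreover have "card (insert x A) = card V"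
      using A False card_V fin_V finite_subset[of A V] by (simp add: proper_subsets_def)
    ultimately have V: "insert x A = V" using fin_V by (simp add: card_subset_eq)
    have inj: "inj_on g V" and gV: "g x \<in> V" using g x by (auto simp: symmetry_def bij_betw_def)
    have "g x \<notin> A"
    proof
      assume "g x \<in> A"
      then have "g (g x) = g x" by (rule fixed)
      then have "g x = x" using inj gV x by (meson inj_onD)
      then show False using \<open>g x \<in> A\<close> False by simp
    qed
    then show ?thesis using gV V by blast
  qed (rule fixed)
qed (use fin_V card_proper in \<open>auto simp: proper_subsets_def\<close>)

text \<open>
  Appending the remaining vertex to a frame gives an enumeration of all \<open>n + 1\<close> vertices. The reflection
  at level \<open>k\<close> exchanges the vertices numbered \<open>k - 1\<close> and \<open>k\<close>; for \<open>k = n\<close> it brings the appended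
  vertex into the frame.
\<close>

lemma reflections:
  assumes v: "frame v"
  shows "\<exists>r. (\<forall>k. 1 \<le> k \<longrightarrow> k \<le> n \<longrightarrow> reflection v k (r k)) \<and> involutions_with_relations n (\<lambda>_. 3) V r"
proof -
  have v: "inj_on v {..<n}" "v ` {..<n} \<subset> V"
    using v unfolding frame_def by (simp_all add: proper_subsets_def)
  obtain a where a: "a \<in> V" "a \<notin> v ` {..<n}" using v by blast
  define w where "w = v(n := a)"
  have wv: "w ` {..<l} = v ` {..<l}" if "l \<le> n" for l using that by (auto simp: w_def image_iff)
  have w_inj: "inj_on w {..n}"
    using v a by (auto simp: w_def inj_on_def)
  have "w ` {..n} \<subseteq> V" using v a by (auto simp: w_def)
  then have V: "V = w ` {..n}"
    using card_image[OF w_inj] card_V fin_V by (metis card_atMost card_subset_eq)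
  define r where "r k = Transposition.transpose (w (k - 1)) (w k)" for k
  have conj: "r k (w j) = w (adj_swap k j)" if "1 \<le> k" "k \<le> n" "j \<in> {..n}" for k j
  proof -
    have "w j = w (k - 1) \<longleftrightarrow> j = k - 1" "w j = w k \<longleftrightarrow> j = k"
      using that inj_on_eq_iff[OF w_inj] by auto
    then show ?thesis by (simp add: r_def Transposition.transpose_def)
  qed
  have "involutions_with_relations n (\<lambda>_. 3) {..n} adj_swap"
    using adj_swap_commute adj_swap_braid by (simp add: involutions_with_relations_def)
  then have rel: "involutions_with_relations n (\<lambda>_. 3) V r"
    using V conj by (rule_tac involutions_with_relations_transfer) (auto simp: Transposition.transpose_def)
  have "reflection v k (r k)" if k: "1 \<le> k" "k \<le> n" for k
    unfolding reflection_def
  proof (intro conjI allI impI)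
    have "w (k - 1) \<in> V" "w k \<in> V" using V k by auto
    then have img: "r k ` V = V" and inj: "inj (r k)" by (simp_all add: r_def inj_transpose)
    show "symmetry V (proper_subsets V) (r k)"
      using img inj_on_subset[OF inj subset_UNIV] image_strict_mono[of "r k" V]
      by (simp add: symmetry_def proper_subsets_def bij_betw_def)
    fix l assume l: "1 \<le> l \<and> l \<le> n"
    have "(r k \<circ> v) ` {..<l} = r k ` w ` {..<l}" unfolding image_comp [symmetric] using wv[of l] l by simp
    also have "\<dots> = w ` adj_swap k ` {..<l}" unfolding image_image using conj k l by (intro image_cong) auto
    finally have "flag_elem (r k \<circ> v) l = w ` adj_swap k ` {..<l}" using l by (simp add: flag_elem_def)
    moreover have "flag_elem v l = w ` {..<l}" using l wv by (simp add: flag_elem_def)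
    moreover have "w ` {..<l} = w ` adj_swap k ` {..<l} \<longleftrightarrow> {..<l} = adj_swap k ` {..<l}"
      using l k by (intro inj_on_image_eq_iff[OF w_inj]) (auto simp: Transposition.transpose_def)
    ultimately show "flag_elem v l = flag_elem (r k \<circ> v) l \<longleftrightarrow> l \<noteq> k"
      by (simp only: adj_swap_initial_segment[OF k(1)])
  qed
  with rel show ?thesis by blast
qed

end

section \<open>The boundary complex of a cross-polytope\<close>

text \<open>
  These vectors are the vertices of the cross-polytope and also the facet normals of the cube. The
  simplices of the boundary complex of the cross-polytope are the sets without antipodal pairs.
\<close>

definition signed_basis :: "'a::euclidean_space set" where
  "signed_basis = Basis \<union> uminus ` Basis"

definition antipode_free :: "'a::euclidean_space set set" where
  "antipode_free = {A. A \<subseteq> signed_basis \<and> (\<forall>x\<in>A. - x \<notin> A)}"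

lemma uminus_in_signed_basis [simp]: "- x \<in> signed_basis \<longleftrightarrow> x \<in> signed_basis"
  by (force simp: signed_basis_def image_iff)

lemma uminus_Basis_notin: "b \<in> Basis \<Longrightarrow> - b \<notin> (Basis :: 'a::euclidean_space set)"
  using inner_Basis[of b "- b"] inner_Basis[of b b] by (auto simp: split: if_splits)

lemma signed_basis_neq_uminus: "x \<in> signed_basis \<Longrightarrow> - x \<noteq> (x :: 'a::euclidean_space)"
proof
  assume "x \<in> signed_basis" "- x = x"
  then have "x \<bullet> x = 1" "(- x) \<bullet> x = x \<bullet> x" by (auto simp: signed_basis_def inner_Basis)
  then show False by (simp only: inner_minus_left)
qed

lemma inner_signed_basis:
  fixes v w :: "'a::euclidean_space"
  assumes "v \<in> signed_basis" "w \<in> signed_basis"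
  shows "v \<bullet> w = (if v = w then 1 else if v = - w then - 1 else 0)"
  using assms uminus_Basis_notin by (auto simp: signed_basis_def inner_Basis)

definition unsign :: "'a::euclidean_space \<Rightarrow> 'a" where
  "unsign x = (if x \<in> Basis then x else - x)"

lemma unsign_in_Basis: "x \<in> signed_basis \<Longrightarrow> unsign x \<in> Basis"
  by (auto simp: signed_basis_def unsign_def)

lemma unsign_eq_iff:
  assumes "x \<in> signed_basis" "y \<in> signed_basis"
  shows "unsign x = unsign y \<longleftrightarrow> x = y \<or> x = - y"
  using assms uminus_Basis_notin by (auto simp: signed_basis_def unsign_def)

text \<open>
  Forgetting signs embeds a simplex into \<open>Basis\<close>, and this reduces all questions about the number
  of vertices to counting basis vectors.
\<close>

lemma antipode_free_unsign_inj: "A \<in> antipode_free \<Longrightarrow> inj_on unsign A"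
  by (rule inj_onI) (metis (no_types, lifting) antipode_free_def unsign_eq_iff mem_Collect_eq subsetD)

lemma antipode_free_card_unsign: "A \<in> antipode_free \<Longrightarrow> card (unsign ` A) = card A"
  by (rule card_image) (rule antipode_free_unsign_inj)

lemma antipode_free_unsign_subset: "A \<in> antipode_free \<Longrightarrow> unsign ` A \<subseteq> Basis"
  using unsign_in_Basis by (auto simp: antipode_free_def)

lemma antipode_free_insert:
  assumes "x \<in> signed_basis" "x \<notin> A"
  shows "insert x A \<in> antipode_free \<longleftrightarrow> A \<in> antipode_free \<and> unsign x \<notin> unsign ` A"
  using assms unsign_eq_iff[OF assms(1)] signed_basis_neq_uminus[OF assms(1)]
  by (auto simp: antipode_free_def image_iff subset_iff)

lemma antipode_free_facet:
  assumes A: "A \<in> antipode_free" "card A = DIM('a)" and x: "x \<in> signed_basis"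
  shows "x \<in> A \<or> - x \<in> (A :: 'a::euclidean_space set)"
proof -
  have "unsign ` A = Basis"
    using antipode_free_unsign_subset[OF A(1)] antipode_free_card_unsign[OF A(1)] A(2)
    by (intro card_subset_eq) auto
  then have "unsign x \<in> unsign ` A" using unsign_in_Basis[OF x] by simp
  then obtain y where "y \<in> A" "unsign x = unsign y" by blast
  moreover have "y \<in> signed_basis" using A \<open>y \<in> A\<close> by (auto simp: antipode_free_def)
  ultimately show ?thesis using unsign_eq_iff[OF x] by auto
qed

lemma signed_basis_thin:
  fixes R :: "'a::euclidean_space set"
  assumes R: "card R = DIM('a) - 1" "x \<notin> R" "y \<notin> R" "z \<notin> R"
    and ins: "insert x R \<in> antipode_free" "insert y R \<in> antipode_free" "insert z R \<in> antipode_free"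
  shows "x = y \<or> x = z \<or> y = z"
proof -
  have sb: "x \<in> signed_basis" "y \<in> signed_basis" "z \<in> signed_basis"
    using ins by (auto simp: antipode_free_def)
  have RK: "R \<in> antipode_free" and out: "unsign x \<notin> unsign ` R" "unsign y \<notin> unsign ` R" "unsign z \<notin> unsign ` R"
    using ins R sb by (simp_all add: antipode_free_insert)
  have "card (Basis - unsign ` R) = 1"
    using antipode_free_unsign_subset[OF RK] antipode_free_card_unsign[OF RK] R(1) DIM_positive[where 'a='a]
    by (subst card_Diff_subset) (auto intro: finite_subset[OF _ finite_Basis])
  then obtain b where "Basis - unsign ` R = {b}" by (rule card_1_singletonE)
  then have "unsign x = b" "unsign y = b" "unsign z = b" using out sb unsign_in_Basis by blast+
  then have "x = y \<or> x = - y" "x = z \<or> x = - z" using unsign_eq_iff sb by metis+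
  then show ?thesis by auto
qed

locale cross_complex =
  fixes V :: "'a::euclidean_space set" and n :: nat
  assumes V_def: "V = signed_basis" and n_def: "n = DIM('a)"
begin

sublocale thin_complex V antipode_free n
proof
  show "finite V" by (simp add: V_def signed_basis_def)
  show "V \<notin> antipode_free"
  proof -
    obtain b :: 'a where "b \<in> Basis" using nonempty_Basis by blast
    then have "b \<in> V" "- b \<in> V" by (simp_all add: V_def) (simp_all add: signed_basis_def)
    then show ?thesis by (auto simp: antipode_free_def)
  qed
  show "{x} \<in> antipode_free" if "x \<in> V" for x
    using that signed_basis_neq_uminus by (auto simp: antipode_free_def V_def)
  show "card A \<le> n" if "A \<in> antipode_free" for A :: "'a set"
    using card_mono[OF finite_Basis antipode_free_unsign_subset[OF that]] antipode_free_card_unsign[OF that]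
    by (simp add: n_def)
  show "\<exists>x. x \<notin> A \<and> insert x A \<in> antipode_free" if A: "A \<in> antipode_free" "card A < n" for A :: "'a set"
  proof -
    have "unsign ` A \<noteq> Basis" using A antipode_free_card_unsign[OF A(1)] n_def by auto
    then obtain b where b: "b \<in> Basis" "b \<notin> unsign ` A" using antipode_free_unsign_subset[OF A(1)] by blast
    have "unsign b = b" using b by (simp add: unsign_def)
    then have "b \<notin> A" using b by (metis imageI)
    moreover have "b \<in> signed_basis" using b by (simp add: signed_basis_def)
    ultimately show ?thesis using antipode_free_insert[of b A] A b \<open>unsign b = b\<close> by auto
  qed
  show "x = y \<or> x = z \<or> y = z"
    if "card R = n - 1" "x \<notin> R" "y \<notin> R" "z \<notin> R" and
      "insert x R \<in> antipode_free" "insert y R \<in> antipode_free" "insert z R \<in> antipode_free" for R and x y z :: 'a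
    using signed_basis_thin that by (simp add: n_def)
  show "g x = x"
    if g: "symmetry V antipode_free g" and A: "A \<in> antipode_free" "card A = n"
      and fixed: "\<And>x. x \<in> A \<Longrightarrow> g x = x" and x: "x \<in> V" for g A x
  proof (cases "x \<in> A")
    case False
    have inj: "inj_on g V" and gV: "g x \<in> V" using g x by (auto simp: symmetry_def bij_betw_def)
    have gx: "g x \<notin> A"
    proof
      assume "g x \<in> A"
      then have "g (g x) = g x" by (rule fixed)
      then have "g x = x" using inj gV x by (meson inj_onD)
      then show False using \<open>g x \<in> A\<close> False by simp
    qed
    define y where "y = - g x"
    have yA: "y \<in> A" using antipode_free_facet[OF A(1) _ , of "g x"] A gx gV by (simp add: y_def n_def V_def)
    show ?thesis
    proof (rule ccontr)
      \<comment> \<open>\<open>x\<close> is joined by an edge to every vertex other than \<open>- x\<close>, but \<open>g x\<close> is antipodal to \<open>g y = y\<close>.\<close>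
      assume "g x \<noteq> x"
      then have "y \<noteq> - x" by (auto simp: y_def)
      moreover have "x \<noteq> - x" "y \<noteq> - y"
        using signed_basis_neq_uminus[of x] signed_basis_neq_uminus[of y] x yA A
        by (auto simp: V_def antipode_free_def)
      moreover have "x \<in> signed_basis" "y \<in> signed_basis" using x yA A by (auto simp: V_def antipode_free_def)
      ultimately have "{x, y} \<in> antipode_free" by (auto simp: antipode_free_def)
      then have "g ` {x, y} \<in> antipode_free" using g unfolding symmetry_def by blast
      moreover have "g ` {x, y} = {- y, y}" using fixed[OF yA] by (simp add: y_def)
      ultimately have "{- y, y} \<in> antipode_free" by (simp only:)
      then show False unfolding antipode_free_def by blast
    qed
  qed (rule fixed)
qed (auto simp: antipode_free_def V_def)

text \<open>
  The pair \<open>(s, j)\<close> stands for \<open>v j\<close>, or for \<open>- v j\<close> if \<open>s\<close> holds. The first \<open>n - 1\<close> reflections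
  exchange consecutive vertices of the frame together with their antipodes, and the last one
  exchanges the last vertex with its antipode.
\<close>

definition signed_swap :: "nat \<Rightarrow> bool \<times> nat \<Rightarrow> bool \<times> nat" where
  "signed_swap k = (\<lambda>(s, j). if k < n then (s, adj_swap k j) else (s \<noteq> (j = n - 1), j))"

lemma signed_swap_relations:
  "involutions_with_relations n (\<lambda>k. if k = n - 1 then 4 else 3) (UNIV \<times> {..<n}) signed_swap"
proof -
  have "signed_swap k (signed_swap k y) = y" for k y
    by (auto simp: signed_swap_def split: prod.splits)
  moreover have "signed_swap k (signed_swap (k + 2) y) = signed_swap (k + 2) (signed_swap k y)"
    if "1 \<le> k" "k + 2 \<le> n" for k y
    using that adj_swap_commute[of k]
    by (cases y) (auto simp: signed_swap_def Transposition.transpose_def)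
  moreover have "((signed_swap k \<circ> signed_swap (k + 1)) ^^ 3) y = y" if "1 \<le> k" "k + 1 < n" for k y
    using that adj_swap_braid[of k "snd y"]
    by (cases y) (auto simp: signed_swap_def numeral_3_eq_3)
  moreover have "((signed_swap k \<circ> signed_swap (k + 1)) ^^ 4) y = y" if "1 \<le> k" "k + 1 = n" for k y
    using that by (cases y) (auto simp: signed_swap_def numeral_eq_Suc Transposition.transpose_def)
  ultimately show ?thesis by (auto simp: involutions_with_relations_def)
qed

lemma reflections:
  assumes fr: "frame v"
  shows "\<exists>r. (\<forall>k. 1 \<le> k \<longrightarrow> k \<le> n \<longrightarrow> reflection v k (r k)) \<and>
    involutions_with_relations n (\<lambda>k. if k = n - 1 then 4 else 3) V r"
proof -
  have v: "inj_on v {..<n}" "v ` {..<n} \<in> antipode_free" using fr unfolding frame_def by auto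
  define w where "w = (\<lambda>(s, j). if s then - v j else v j)"
  let ?D = "UNIV \<times> {..<n} :: (bool \<times> nat) set"
  have vj: "v j \<in> signed_basis" "- v j \<notin> v ` {..<n}" if "j < n" for j
    using v(2) that by (auto simp: antipode_free_def)
  have w_inj: "inj_on w ?D"
  proof (rule inj_onI; clarsimp)
    fix s i t j assume ij: "i < n" "j < n" and eq: "w (s, i) = w (t, j)"
    show "s = t \<and> i = j"
    proof (cases "s = t")
      case True
      then have "v i = v j" using eq by (auto simp: w_def split: if_splits)
      then show ?thesis using True v(1) ij by (simp add: inj_on_eq_iff)
    next
      case False
      then have "- v i = v j \<or> - v j = v i" using eq by (auto simp: w_def split: if_splits)
      then show ?thesis using vj ij by (metis imageI lessThan_iff)
    qed
  qed
  have V: "V = w ` ?D"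
  proof
    show "w ` ?D \<subseteq> V" using vj by (auto simp: w_def V_def)
    show "V \<subseteq> w ` ?D"
    proof
      fix x assume "x \<in> V"
      moreover have "card (v ` {..<n}) = n" using v(1) by (simp add: card_image)
      ultimately have "x \<in> v ` {..<n} \<or> - x \<in> v ` {..<n}"
        using antipode_free_facet[OF v(2)] by (simp add: V_def n_def)
      then obtain j where "j < n" "x = v j \<or> x = - v j" by (metis (no_types, lifting) imageE lessThan_iff minus_minus)
      then have "x = w (False, j) \<or> x = w (True, j)" "j < n" by (auto simp: w_def)
      then show "x \<in> w ` ?D" by auto
    qed
  qed
  define r where "r k = w \<circ> signed_swap k \<circ> inv_into ?D w" for k
  have conj: "r k (w y) = w (signed_swap k y)" if "y \<in> ?D" for k y
    using that w_inj by (simp add: r_def)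
  have closed: "signed_swap k y \<in> ?D" if "1 \<le> k" "k \<le> n" "y \<in> ?D" for k y
    using that by (auto simp: signed_swap_def Transposition.transpose_def split: prod.splits)
  have rel: "involutions_with_relations n (\<lambda>k. if k = n - 1 then 4 else 3) V r"
    using involutions_with_relations_transfer[OF V conj closed signed_swap_relations] .
  have odd: "r k (- x) = - r k x" if "x \<in> V" for k x
  proof -
    have "x \<in> w ` ?D" using that V by blast
    then obtain s j where x: "x = w (s, j)" "j < n" by blast
    have "- x = w (\<not> s, j)" using x by (simp add: w_def)
    moreover have "w (signed_swap k (\<not> s, j)) = - w (signed_swap k (s, j))"
      by (auto simp: signed_swap_def w_def)
    ultimately show ?thesis using conj x by simp
  qed
  have "reflection v k (r k)" if k: "1 \<le> k" "k \<le> n" for k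
    unfolding reflection_def
  proof (intro conjI allI impI)
    have rV: "r k x \<in> V" "r k (r k x) = x" if "x \<in> V" for x
      using that V conj closed k rel by (auto simp: involutions_with_relations_def)
    then have bij: "bij_betw (r k) V V" by (intro bij_betw_byWitness[where f' = "r k"]) auto
    have "r k ` A \<in> antipode_free" if A: "A \<in> antipode_free" for A
    proof -
      have AV: "A \<subseteq> V" using A by (simp add: antipode_free_def V_def)
      have "False" if "x \<in> A" "y \<in> A" "r k x = - r k y" for x y
      proof -
        have "r k x = r k (- y)" using odd that AV by auto
        moreover have "x \<in> V" "- y \<in> V" using that AV by (auto simp: V_def)
        ultimately have "x = - y" using bij by (meson bij_betw_def inj_onD)
        then show False using A that by (auto simp: antipode_free_def)
      qed
      then show ?thesis using rV AV by (force simp: antipode_free_def V_def)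
    qed
    with bij show "symmetry V antipode_free (r k)" by (simp add: symmetry_def)
    fix l assume l: "1 \<le> l \<and> l \<le> n"
    have vw: "v j = w (False, j)" for j by (simp add: w_def)
    have rv: "(r k \<circ> v) j = (if k < n then v (adj_swap k j) else if j = n - 1 then - v j else v j)" if "j < n" for j
      using conj[of "(False, j)" k] that by (simp add: vw[of j]) (auto simp: signed_swap_def w_def)
    show "flag_elem v l = flag_elem (r k \<circ> v) l \<longleftrightarrow> l \<noteq> k"
    proof (cases "k < n")
      case True
      have "(r k \<circ> v) ` {..<l} = v ` adj_swap k ` {..<l}"
        unfolding image_image using rv True l by (intro image_cong) auto
      moreover have "v ` {..<l} = v ` adj_swap k ` {..<l} \<longleftrightarrow> {..<l} = adj_swap k ` {..<l}"
        using l True by (intro inj_on_image_eq_iff[OF v(1)]) (auto simp: Transposition.transpose_def)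
      ultimately show ?thesis
        using adj_swap_initial_segment[OF k(1), of l] l by (simp add: flag_elem_def)
    next
      case False
      then have kn: "k = n" using k by simp
      show ?thesis
      proof (cases "l = n")
        case True
        have "(r k \<circ> v) (n - 1) = - v (n - 1)" using rv[of "n - 1"] kn l by simp
        moreover have "n - 1 \<in> {..<l}" using True l by simp
        ultimately have "- v (n - 1) \<in> (r k \<circ> v) ` {..<l}" by (metis imageI)
        then have "v ` {..<l} \<noteq> (r k \<circ> v) ` {..<l}" using vj(2)[of "n - 1"] True l by auto
        then show ?thesis using True kn by (simp add: flag_elem_def)
      next
        case False
        have "(r k \<circ> v) ` {..<l} = v ` {..<l}" using rv kn l False by (intro image_cong) auto
        then show ?thesis using False kn l by (simp add: flag_elem_def)
      qed
    qed
  qed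
  with rel show ?thesis by blast
qed

end

section \<open>The face lattices of the three polytopes\<close>

lemma (in thin_complex) face_representationI:
  fixes P :: "'b::euclidean_space set"
  assumes dim: "n = DIM('b)"
    and order: "\<And>A B. A \<in> lattice \<Longrightarrow> B \<in> lattice \<Longrightarrow> h A \<subseteq> h B \<longleftrightarrow> (if reversed then B \<subseteq> A else A \<subseteq> B)"
    and faces: "faces P = h ` lattice"
  shows "face_representation V K n P h reversed"
proof unfold_locales
  have "inj_on h lattice"
    by (rule inj_onI) (metis order subset_antisym order_refl)
  then show "bij_betw h lattice (faces P)" by (simp add: bij_betw_def faces)
qed (use dim order in auto)

definition simplex_vertices :: "'a::euclidean_space set" where
  "simplex_vertices = insert (((1 - sqrt (real DIM('a) + 1)) / real DIM('a)) *\<^sub>R One) Basis"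

lemma regular_simplex_eq: "regular_simplex = convex hull simplex_vertices"
  by (simp add: regular_simplex_def simplex_vertices_def)

text \<open>
  The coordinates of the points of the affine hull of \<open>Basis\<close> add up to 1, those of the additional
  vertex to \<open>1 - sqrt (n + 1)\<close>.
\<close>

lemma simplex_apex_notin_affine_hull:
  "((1 - sqrt (real DIM('a) + 1)) / real DIM('a)) *\<^sub>R One \<notin> affine hull (Basis :: 'a::euclidean_space set)"
proof
  let ?c = "(1 - sqrt (real DIM('a) + 1)) / real DIM('a)"
  assume "?c *\<^sub>R One \<in> affine hull (Basis :: 'a set)"
  moreover have "affine hull (Basis :: 'a set) \<subseteq> {x. One \<bullet> x = 1}"
  proof (rule hull_minimal)
    show "affine {x :: 'a. One \<bullet> x = 1}" by (rule affine_hyperplane)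
  qed (auto simp: inner_sum_left inner_Basis)
  ultimately have "One \<bullet> (?c *\<^sub>R One :: 'a) = 1" by blast
  moreover have "(One :: 'a) \<bullet> One = real DIM('a)" by (simp add: inner_sum_left inner_sum_right inner_Basis)
  ultimately have "?c * real DIM('a) = 1" by simp
  then show False by simp
qed

lemma simplex_vertices_independent: "\<not> affine_dependent (simplex_vertices :: 'a::euclidean_space set)"
  unfolding simplex_vertices_def
proof (rule affine_independent_insert)
  show "\<not> affine_dependent (Basis :: 'a set)"
    using independent_Basis affine_dependent_imp_dependent by blast
qed (rule simplex_apex_notin_affine_hull)

lemma card_simplex_vertices: "card (simplex_vertices :: 'a::euclidean_space set) = Suc DIM('a)"
proof -
  let ?c = "((1 - sqrt (real DIM('a) + 1)) / real DIM('a)) *\<^sub>R One :: 'a"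
  have "?c \<notin> Basis" using simplex_apex_notin_affine_hull hull_inc[of ?c Basis affine] by blast
  then show ?thesis by (simp add: simplex_vertices_def)
qed

lemma convex_hull_subset_iff_affine_independent:
  assumes V: "\<not> affine_dependent V" and AB: "A \<subseteq> V" "B \<subseteq> V"
  shows "convex hull A \<subseteq> convex hull B \<longleftrightarrow> A \<subseteq> B"
proof
  assume hull: "convex hull A \<subseteq> convex hull B"
  show "A \<subseteq> B"
  proof
    fix x assume x: "x \<in> A"
    show "x \<in> B"
    proof (rule ccontr)
      assume "x \<notin> B"
      then have "B \<subseteq> V - {x}" using AB by blast
      then have "affine hull B \<subseteq> affine hull (V - {x})" by (rule hull_mono)
      moreover have "x \<in> convex hull B" using hull hull_inc[OF x, of convex] by blast
      ultimately have "x \<in> affine hull (V - {x})" using convex_hull_subset_affine_hull by blast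
      then show False using V x AB by (auto simp: affine_dependent_def)
    qed
  qed
qed (rule hull_mono)

lemma simplex_rotation_relations:
  fixes \<Phi> :: "'a::euclidean_space set set"
  assumes "flag regular_simplex \<Phi>"
  shows "rotation_relations DIM('a) (\<lambda>_. 3) regular_simplex \<Phi>"
proof -
  let ?V = "simplex_vertices :: 'a set"
  interpret S: simplex_complex ?V "DIM('a)"
    by unfold_locales (auto simp: card_simplex_vertices DIM_positive Suc_leI)
  have lat: "S.lattice = Pow ?V" unfolding S.lattice_def by (auto simp: proper_subsets_def)
  interpret R: face_representation ?V "proper_subsets ?V" "DIM('a)" regular_simplex "\<lambda>A. convex hull A" False
  proof (rule S.face_representationI)
    show "faces regular_simplex = (\<lambda>A. convex hull A) ` S.lattice"
      unfolding lat faces_def regular_simplex_eq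
        face_of_convex_hull_affine_independent[OF simplex_vertices_independent] by auto
  qed (simp_all add: convex_hull_subset_iff_affine_independent[OF simplex_vertices_independent] lat)
  obtain v where v: "S.frame v" "\<Phi> = (\<lambda>A. convex hull A) ` S.frame_flag v"
    using assms R.flag_iff by blast
  obtain r where "\<forall>k. 1 \<le> k \<longrightarrow> k \<le> DIM('a) \<longrightarrow> S.reflection v k (r k)"
    "involutions_with_relations DIM('a) (\<lambda>_. 3) ?V r"
    using S.reflections[OF v(1)] by blast
  then show ?thesis using R.rotation_relations[OF v(1), of r "\<lambda>_. 3"] v(2) by simp
qed

text \<open>
  The vector \<open>\<Sum>A\<close> plays two parts: if nonzero, it is the normal of a supporting hyperplane of the cross-polytope
  that contains exactly the vertices in \<open>A\<close>, and it is a point of the cube that lies on exactly the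
  facets with normals in \<open>A\<close>.
\<close>

lemma inner_sum_antipode_free:
  fixes A :: "'a::euclidean_space set"
  assumes A: "A \<in> antipode_free" and w: "w \<in> signed_basis"
  shows "\<Sum>A \<bullet> w = (if w \<in> A then 1 else if - w \<in> A then - 1 else 0)"
proof -
  have fin: "finite A" using A finite_subset[of A signed_basis] by (auto simp: antipode_free_def signed_basis_def)
  have sub: "A \<subseteq> signed_basis" using A by (simp add: antipode_free_def)
  have "\<Sum>A \<bullet> w = (\<Sum>v\<in>A. v \<bullet> w)" by (simp add: inner_sum_left)
  also have "\<dots> = (\<Sum>v\<in>A. (if v = w then 1 else 0) + (if v = - w then - 1 else 0))"
    using sub w signed_basis_neq_uminus[OF w] by (intro sum.cong) (auto simp: inner_signed_basis subset_iff)
  also have "\<dots> = (if w \<in> A then 1 else 0) + (if - w \<in> A then - 1 else 0)"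
    using fin by (simp add: sum.distrib)
  also have "\<dots> = (if w \<in> A then 1 else if - w \<in> A then - 1 else 0)"
    using A by (auto simp: antipode_free_def)
  finally show ?thesis .
qed

lemma inner_sum_antipode_free_le:
  "A \<in> antipode_free \<Longrightarrow> w \<in> signed_basis \<Longrightarrow> \<Sum>A \<bullet> w \<le> 1"
  by (simp add: inner_sum_antipode_free)

lemma inner_sum_antipode_free_eq_1:
  "A \<in> antipode_free \<Longrightarrow> w \<in> signed_basis \<Longrightarrow> \<Sum>A \<bullet> w = 1 \<longleftrightarrow> w \<in> A"
  by (simp add: inner_sum_antipode_free)

lemma cross_polytope_eq: "cross_polytope = convex hull signed_basis"
  by (simp add: cross_polytope_def signed_basis_def)

lemma cross_polytope_face:
  assumes A: "A \<in> antipode_free" shows "convex hull A face_of cross_polytope"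
proof -
  let ?H = "{x. \<Sum>A \<bullet> x = 1}"
  have "cross_polytope \<subseteq> {x. \<Sum>A \<bullet> x \<le> 1}"
    unfolding cross_polytope_eq using inner_sum_antipode_free_le[OF A]
    by (intro hull_minimal) (auto simp: convex_halfspace_le)
  then have F: "(cross_polytope \<inter> ?H) face_of cross_polytope"
    by (intro face_of_Int_supporting_hyperplane_le) (auto simp: cross_polytope_eq)
  moreover have "compact (signed_basis :: 'a set)"
    by (rule finite_imp_compact) (simp add: signed_basis_def)
  ultimately obtain S where S: "S \<subseteq> signed_basis" "cross_polytope \<inter> ?H = convex hull S"
    unfolding cross_polytope_eq by (metis face_of_convex_hull_subset)
  have "S \<subseteq> ?H" using S(2) hull_subset[of S convex] by blast
  then have "S \<subseteq> A" using S(1) inner_sum_antipode_free_eq_1[OF A] by blast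
  moreover have "convex hull A \<subseteq> cross_polytope \<inter> ?H"
  proof (rule hull_minimal)
    have "A \<subseteq> signed_basis" using A by (simp add: antipode_free_def)
    then show "A \<subseteq> cross_polytope \<inter> ?H"
      using inner_sum_antipode_free_eq_1[OF A] hull_subset[of signed_basis convex]
      unfolding cross_polytope_eq by blast
    show "convex (cross_polytope \<inter> ?H)"
      by (simp add: cross_polytope_eq convex_Int convex_hyperplane)
  qed
  ultimately have "convex hull A = cross_polytope \<inter> ?H" using S(2) hull_mono by blast
  then show ?thesis using F by simp
qed

text \<open>
  A face containing a vertex and its antipode contains the origin. As the origin is the midpoint of
  every pair of antipodal vertices, such a face contains all vertices.
\<close>

lemma cross_polytope_face_imp:
  fixes F :: "'a::euclidean_space set"
  assumes F: "F face_of cross_polytope" and ne: "F \<noteq> cross_polytope"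
  shows "\<exists>A\<in>antipode_free. F = convex hull A"
proof -
  have "compact (signed_basis :: 'a set)"
    by (rule finite_imp_compact) (simp add: signed_basis_def)
  then obtain S where S: "S \<subseteq> signed_basis" "F = convex hull S"
    using F unfolding cross_polytope_eq by (metis face_of_convex_hull_subset)
  have "- x \<notin> S" if x: "x \<in> S" for x
  proof
    assume mx: "- x \<in> S"
    have convF: "convex F" using F by (rule face_of_imp_convex)
    have "x \<in> F" "- x \<in> F" using x mx S(2) by (auto simp: hull_inc)
    then have "(1/2) *\<^sub>R x + (1/2) *\<^sub>R (- x) \<in> F" using convF by (intro convexD) auto
    then have "0 \<in> F" by simp
    have "w \<in> F" if w: "w \<in> signed_basis" for w
    proof -
      have "0 \<in> open_segment w (- w)"
        using signed_basis_neq_uminus[OF w] by (auto simp: in_segment intro!: exI[of _ "1/2"] simp flip: scaleR_add_left)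
      moreover have "w \<in> cross_polytope" "- w \<in> cross_polytope"
        using w by (auto simp: cross_polytope_eq hull_inc)
      ultimately show ?thesis using F \<open>0 \<in> F\<close> unfolding face_of_def by blast
    qed
    then have "cross_polytope \<subseteq> F" unfolding cross_polytope_eq using convF by (intro hull_minimal) auto
    then show False using ne face_of_imp_subset[OF F] by blast
  qed
  then have "S \<in> antipode_free" using S(1) by (simp add: antipode_free_def)
  with S(2) show ?thesis by blast
qed

lemma cross_polytope_rotation_relations:
  fixes \<Phi> :: "'a::euclidean_space set set"
  assumes "flag cross_polytope \<Phi>"
  shows "rotation_relations DIM('a) (\<lambda>i. if i = DIM('a) - 1 then 4 else 3) cross_polytope \<Phi>"
proof -
  let ?V = "signed_basis :: 'a set"
  interpret S: cross_complex ?V "DIM('a)" by unfold_locales auto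
  have vertex: "w \<in> convex hull A \<longleftrightarrow> w \<in> A" if w: "w \<in> ?V" and A: "A \<in> S.lattice" for w A
  proof (cases "A = ?V")
    case False
    then have AK: "A \<in> antipode_free" using A by (simp add: S.lattice_def)
    then have "A \<subseteq> {x. \<Sum>A \<bullet> x = 1}"
      using inner_sum_antipode_free_eq_1[OF AK] by (auto simp: antipode_free_def subset_iff)
    then have "convex hull A \<subseteq> {x. \<Sum>A \<bullet> x = 1}"
      by (intro hull_minimal) (auto simp: convex_hyperplane)
    then show ?thesis using inner_sum_antipode_free_eq_1[OF AK w] hull_inc[of w A convex] by blast
  qed (use w hull_inc in auto)
  interpret R: face_representation ?V antipode_free "DIM('a)" cross_polytope "\<lambda>A. convex hull A" False
  proof (rule S.face_representationI)
    show "convex hull A \<subseteq> convex hull B \<longleftrightarrow> (if False then B \<subseteq> A else A \<subseteq> B)"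
      if AB: "A \<in> S.lattice" "B \<in> S.lattice" for A B
    proof -
      have "A \<subseteq> B" if "convex hull A \<subseteq> convex hull B"
        using that vertex S.lattice_subset AB by (meson hull_inc subset_iff)
      then show ?thesis using hull_mono[of A B convex] by auto
    qed
    have "cross_polytope face_of (cross_polytope :: 'a set)"
      by (rule face_of_refl) (simp add: cross_polytope_eq)
    then show "faces cross_polytope = (\<lambda>A. convex hull A) ` S.lattice"
      using cross_polytope_face cross_polytope_face_imp
      by (auto simp: faces_def S.lattice_def simp flip: cross_polytope_eq)
  qed simp
  obtain v where v: "S.frame v" "\<Phi> = (\<lambda>A. convex hull A) ` S.frame_flag v"
    using assms R.flag_iff by blast
  let ?q = "\<lambda>k. if k = DIM('a) - 1 then 4 else 3"
  obtain r where "\<forall>k. 1 \<le> k \<longrightarrow> k \<le> DIM('a) \<longrightarrow> S.reflection v k (r k)"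
    "involutions_with_relations DIM('a) ?q ?V r"
    using S.reflections[OF v(1)] by blast
  then show ?thesis using R.rotation_relations[OF v(1), of r ?q] v(2) by simp
qed

definition cube_face :: "'a::euclidean_space set \<Rightarrow> 'a set" where
  "cube_face A = {x \<in> cube. \<forall>v\<in>A. v \<bullet> x = 1}"

lemma cube_iff: "x \<in> cube \<longleftrightarrow> (\<forall>w\<in>signed_basis. w \<bullet> x \<le> 1)"
proof -
  have "One \<bullet> i = 1" if "i \<in> Basis" for i :: 'a
    using that by (simp add: inner_sum_left inner_Basis)
  then have "x \<in> cube \<longleftrightarrow> (\<forall>i\<in>Basis. - 1 \<le> i \<bullet> x \<and> i \<bullet> x \<le> 1)"
    by (simp add: cube_def mem_box inner_commute[of x])
  then show ?thesis by (auto simp: signed_basis_def ball_Un)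
qed

lemma convex_cube: "convex cube"
  by (simp add: cube_def convex_box)

lemma cube_face_face_of:
  assumes "A \<subseteq> signed_basis" shows "cube_face A face_of (cube :: 'a::euclidean_space set)"
proof (cases "A = {}")
  case True
  then show ?thesis by (simp add: cube_face_def face_of_refl convex_cube)
next
  case False
  have eq: "cube_face A = \<Inter> ((\<lambda>v. cube \<inter> {x. v \<bullet> x = 1}) ` A)" using False by (auto simp: cube_face_def)
  have "(cube \<inter> {x. v \<bullet> x = 1}) face_of cube" if "v \<in> A" for v
    using assms that by (intro face_of_Int_supporting_hyperplane_le) (auto simp: cube_iff convex_cube)
  then show ?thesis unfolding eq using False by (intro face_of_Inter) blast+
qed

lemma sum_in_cube_face:
  assumes A: "A \<in> antipode_free" shows "\<Sum>A \<in> cube_face A"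
proof -
  have "A \<subseteq> signed_basis" using A by (simp add: antipode_free_def)
  then have "v \<bullet> \<Sum>A = 1" if "v \<in> A" for v
    using that inner_sum_antipode_free_eq_1[OF A, of v] by (simp add: inner_commute subset_iff)
  moreover have "w \<bullet> \<Sum>A \<le> 1" if "w \<in> signed_basis" for w
    using inner_sum_antipode_free_le[OF A that] by (simp add: inner_commute)
  ultimately show ?thesis by (simp add: cube_face_def cube_iff)
qed

lemma cube_face_antipodal:
  assumes "x \<in> A" "- x \<in> A" shows "cube_face A = {}"
proof -
  have "False" if "y \<in> cube_face A" for y
  proof -
    have "x \<bullet> y = 1" "(- x) \<bullet> y = 1" using that assms unfolding cube_face_def by blast+
    then show False by simp
  qed
  then show ?thesis by blast
qed

text \<open>
  Let \<open>A\<close> be the set of normals of the facets that contain \<open>F\<close>. A relative interior point \<open>p\<close> of \<open>F\<close>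
  satisfies the other facet inequalities strictly, so for every point \<open>x\<close> of \<open>cube_face A\<close> the
  segment from \<open>x\<close> to \<open>p\<close> can be prolonged beyond \<open>p\<close> inside the cube. Since \<open>F\<close> is a face, it
  contains \<open>x\<close>.
\<close>

lemma face_of_cube_imp:
  fixes F :: "'a::euclidean_space set"
  assumes F: "F face_of cube" and ne: "F \<noteq> {}"
  shows "\<exists>A\<in>antipode_free. F = cube_face A"
proof -
  define A where "A = {v \<in> signed_basis. \<forall>x\<in>F. v \<bullet> x = 1}"
  have Fc: "F \<subseteq> cube" and convF: "convex F" using F face_of_imp_subset face_of_imp_convex by auto
  have sub: "A \<subseteq> signed_basis" by (auto simp: A_def)
  have "F \<subseteq> cube_face A" using Fc by (auto simp: cube_face_def A_def)
  moreover have "cube_face A \<subseteq> F"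
  proof
    fix x assume x: "x \<in> cube_face A"
    obtain p where p: "p \<in> rel_interior F" using ne convF rel_interior_eq_empty by blast
    then have pF: "p \<in> F" using rel_interior_subset by blast
    have strict: "w \<bullet> p < 1" if w: "w \<in> signed_basis - A" for w
    proof (rule ccontr)
      assume "\<not> w \<bullet> p < 1"
      moreover have "w \<bullet> p \<le> 1" using w pF Fc by (auto simp: cube_iff)
      ultimately have "p \<in> F \<inter> {x. w \<bullet> x = 1}" using pF by simp
      moreover have "F \<inter> {x. w \<bullet> x = 1} face_of F"
        using convF Fc w by (intro face_of_Int_supporting_hyperplane_le) (auto simp: cube_iff)
      ultimately have "F \<inter> {x. w \<bullet> x = 1} = F" using face_of_disjoint_rel_interior p by blast
      then show False using w by (auto simp: A_def)
    qed
    have fin: "finite (signed_basis - A)" by (simp add: signed_basis_def)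
    have "\<exists>e>0. \<forall>w\<in>signed_basis - A. w \<bullet> p + e * (w \<bullet> (p - x)) < 1"
    proof -
      have "\<forall>\<^sub>F e in at_right 0. w \<bullet> p + e * (w \<bullet> (p - x)) < 1" if w: "w \<in> signed_basis - A" for w
      proof -
        have "((\<lambda>e. w \<bullet> p + e * (w \<bullet> (p - x))) \<longlongrightarrow> w \<bullet> p + 0 * (w \<bullet> (p - x))) (at_right 0)"
          by (intro tendsto_intros)
        then show ?thesis using strict[OF w] by (intro order_tendstoD(2)) auto
      qed
      then have "\<forall>\<^sub>F e in at_right (0::real). \<forall>w\<in>signed_basis - A. w \<bullet> p + e * (w \<bullet> (p - x)) < 1"
        using fin by (simp add: eventually_ball_finite)
      then have "\<forall>\<^sub>F e in at_right (0::real). e > 0 \<and> (\<forall>w\<in>signed_basis - A. w \<bullet> p + e * (w \<bullet> (p - x)) < 1)"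
        using eventually_at_right_less[of "0::real"] by eventually_elim auto
      then show ?thesis using eventually_happens' trivial_limit_at_right_real by blast
    qed
    then obtain e where e: "e > 0" and lt: "\<And>w. w \<in> signed_basis - A \<Longrightarrow> w \<bullet> p + e * (w \<bullet> (p - x)) < 1"
      by blast
    \<comment> \<open>The end point of the prolonged segment.\<close>
    define y where "y = p + e *\<^sub>R (p - x)"
    have "w \<bullet> y \<le> 1" if w: "w \<in> signed_basis" for w
    proof (cases "w \<in> A")
      case True
      then have "w \<bullet> p = 1" "w \<bullet> x = 1" using pF x by (auto simp: A_def cube_face_def)
      then show ?thesis by (simp add: y_def inner_add_right inner_diff_right)
    next
      case False
      then show ?thesis using lt[of w] w by (simp add: y_def inner_add_right)
    qed
    then have yc: "y \<in> cube" by (simp add: cube_iff)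
    have xc: "x \<in> cube" using x by (simp add: cube_face_def)
    show "x \<in> F"
    proof (cases "x = p")
      case False
      have "y - x = (1 + e) *\<^sub>R (p - x)" by (simp add: y_def algebra_simps)
      then have "p = (1 - 1 / (1 + e)) *\<^sub>R x + (1 / (1 + e)) *\<^sub>R y" using e
        by (simp add: y_def algebra_simps flip: scaleR_add_left) (simp add: field_simps flip: scaleR_add_left)
      moreover have "x \<noteq> y" using \<open>y - x = _\<close> False e by auto
      moreover have "0 < 1 / (1 + e)" "1 / (1 + e) < 1" using e by auto
      ultimately have "p \<in> open_segment x y" unfolding in_segment by blast
      then show ?thesis using F pF xc yc unfolding face_of_def by blast
    qed (use pF in simp)
  qed
  ultimately have eq: "F = cube_face A" by simp
  then have "A \<in> antipode_free" using sub ne cube_face_antipodal by (auto simp: antipode_free_def)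
  with eq show ?thesis by blast
qed

lemma cube_rotation_relations:
  fixes \<Phi> :: "'a::euclidean_space set set"
  assumes "flag cube \<Phi>"
  shows "rotation_relations DIM('a) (\<lambda>i. if DIM('a) - i = DIM('a) - 1 then 4 else 3) cube \<Phi>"
proof -
  let ?V = "signed_basis :: 'a set"
  interpret S: cross_complex ?V "DIM('a)" by unfold_locales auto
  have top: "cube_face ?V = {}"
  proof -
    obtain b :: 'a where "b \<in> Basis" using nonempty_Basis by blast
    then have "b \<in> ?V" by (simp add: signed_basis_def)
    then show ?thesis using cube_face_antipodal[of b ?V] by simp
  qed
  interpret R: face_representation ?V antipode_free "DIM('a)" cube cube_face True
  proof (rule S.face_representationI)
    show "cube_face A \<subseteq> cube_face B \<longleftrightarrow> (if True then B \<subseteq> A else A \<subseteq> B)"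
      if AB: "A \<in> S.lattice" "B \<in> S.lattice" for A B
    proof -
      have "B \<subseteq> A" if sub: "cube_face A \<subseteq> cube_face B"
      proof (cases "A = ?V")
        case False
        then have A: "A \<in> antipode_free" using AB by (simp add: S.lattice_def)
        then have "\<Sum>A \<in> cube_face B" using sub sum_in_cube_face by blast
        then have "v \<in> A" if "v \<in> B" for v
          using that inner_sum_antipode_free_eq_1[OF A, of v] S.lattice_subset[OF AB(2)]
          by (auto simp: cube_face_def inner_commute)
        then show ?thesis by blast
      qed (use S.lattice_subset AB in blast)
      then show ?thesis by (auto simp: cube_face_def)
    qed
    show "faces cube = cube_face ` S.lattice"
    proof
      show "faces cube \<subseteq> cube_face ` S.lattice"
        using face_of_cube_imp top by (fastforce simp: faces_def S.lattice_def)
      show "cube_face ` S.lattice \<subseteq> faces cube"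
        using cube_face_face_of S.lattice_subset by (auto simp: faces_def)
    qed
  qed simp
  obtain v where v: "S.frame v" "\<Phi> = cube_face ` S.frame_flag v"
    using assms R.flag_iff by blast
  let ?q = "\<lambda>k. if k = DIM('a) - 1 then 4 else 3"
  obtain r where "\<forall>k. 1 \<le> k \<longrightarrow> k \<le> DIM('a) \<longrightarrow> S.reflection v k (r k)"
    "involutions_with_relations DIM('a) ?q ?V r"
    using S.reflections[OF v(1)] by blast
  then show ?thesis using R.rotation_relations[OF v(1), of r ?q] v(2) by simp
qed

section \<open>Mixes of the three polytopes\<close>

lemma rotation_group_sel [simp]:
  "carrier (rotation_group n (P, \<Phi>)) = generate (Aut P) {sigma P \<Phi> i | i. 1 \<le> i \<and> i \<le> n - 1}"
  "mult (rotation_group n (P, \<Phi>)) = mult (Aut P)" "one (rotation_group n (P, \<Phi>)) = one (Aut P)"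
  by (simp_all add: rotation_group_def)

lemma rotation_group_pow: "x [^]\<^bsub>rotation_group n (P, \<Phi>)\<^esub> (m::nat) = x [^]\<^bsub>Aut P\<^esub> m"
  by (induction m) (simp_all only: nat_pow_0 nat_pow_Suc rotation_group_sel)

text \<open>
  The assumption on the exponents covers the three Schlaefli types: no entry 4 for the simplex, the
  first entry for the cube, the last one for the cross-polytope. As the types are distinct, at most one
  factor has the exponent 4 at a given index, and at most one factor has no 4 at all. Factors of the former
  kind are isolated at their exceptional index, and from there single steps reach their other
  generators; the remaining factor is what is then left of the diagonal generators.
\<close>

lemma mix_eq_product:
  fixes Ps :: "('a::euclidean_space set \<times> 'a set set) list" and ps :: "(nat \<Rightarrow> nat) list"
  assumes n: "3 \<le> n"
    and relations: "list_all2 (\<lambda>p (P, \<Phi>). rotation_relations n p P \<Phi>) ps Ps"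
    and types: "set ps \<subseteq> {\<lambda>_. 3, (\<lambda>_. 3)(1 := 4), (\<lambda>_. 3)(n - 1 := 4)}"
    and distinct: "distinct ps"
  shows "rotation_group_mix n Ps = rotation_group_product n Ps"
proof -
  define p where "p = (!) ps"
  have len: "length ps = length Ps" using relations by (rule list_all2_lengthD)
  have rel: "rotation_relations n (p r) (fst (Ps ! r)) (snd (Ps ! r))" if "r < length Ps" for r
    using list_all2_nthD2[OF relations that] by (simp add: p_def split_beta)
  have types: "p r = (\<lambda>_. 3) \<or> p r = (\<lambda>_. 3)(1 := 4) \<or> p r = (\<lambda>_. 3)(n - 1 := 4)"
    if "r < length Ps" for r
  proof -
    have "ps ! r \<in> set ps" using that len by simp
    then show ?thesis using types unfolding p_def by blast
  qed
  have distinct_types: "inj_on p {..<length Ps}"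
    unfolding p_def using len distinct by (simp add: inj_on_nth)
  let ?I = "{..<length Ps}" and ?J = "{i. 1 \<le> i \<and> i \<le> n - 1}"
  define G where "G r = rotation_group n (Ps ! r)" for r
  define s where "s r i = sigma (fst (Ps ! r)) (snd (Ps ! r)) i" for r i
  have G_eq: "G r = rotation_group n (fst (Ps ! r), snd (Ps ! r))" for r by (simp add: G_def)
  have s_closed: "s r i \<in> carrier (Aut (fst (Ps ! r)))" if "r \<in> ?I" "i \<in> ?J" for r i
    using rel[of r] that by (simp add: rotation_relations_def s_def)
  have gens: "{sigma (fst (Ps ! r)) (snd (Ps ! r)) i | i. 1 \<le> i \<and> i \<le> n - 1} = s r ` ?J" for r
    by (auto simp: s_def)
  have carr: "carrier (G r) = generate (Aut (fst (Ps ! r))) (s r ` ?J)" for r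
    by (simp only: G_eq rotation_group_sel gens)
  have sub: "subgroup (carrier (G r)) (Aut (fst (Ps ! r)))" if "r \<in> ?I" for r
    unfolding carr using s_closed[OF that] by (intro group.generate_is_subgroup[OF group_Aut]) blast
  have G_upd: "G r = (Aut (fst (Ps ! r)))\<lparr>carrier := carrier (G r)\<rparr>" for r
    by (simp add: G_def rotation_group_def split: prod.splits)
  have grp: "group (G r)" if "r \<in> ?I" for r
    using subgroup.subgroup_is_group[OF sub[OF that] group_Aut] G_upd by metis
  have s_in_G: "s r i \<in> carrier (G r)" if "i \<in> ?J" for r i
    unfolding carr using that by (intro generate.incl) blast
  interpret M: group_mix ?I G ?J s
  proof (rule group_mix.intro)
    show "carrier (G r) \<subseteq> generate (G r) (s r ` ?J)" if "r \<in> ?I" for r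
    proof -
      have "generate ((Aut (fst (Ps ! r)))\<lparr>carrier := carrier (G r)\<rparr>) (s r ` ?J) = generate (Aut (fst (Ps ! r))) (s r ` ?J)"
        using s_in_G by (intro group.generate_consistent[OF group_Aut _ sub[OF that]]) blast
      then show ?thesis using G_upd[of r] carr[of r] by simp
    qed
  qed (use grp s_in_G in blast)+
  have order: "s r i [^]\<^bsub>G r\<^esub> p r i = \<one>\<^bsub>G r\<^esub>" if "r \<in> ?I" "i \<in> ?J" for r i
    using rel[of r] that unfolding G_eq rotation_group_pow rotation_group_sel s_def
    by (simp add: rotation_relations_def)
  have order2: "(s r i \<otimes>\<^bsub>G r\<^esub> s r (i + 1)) [^]\<^bsub>G r\<^esub> (2::nat) = \<one>\<^bsub>G r\<^esub>"
    if "r \<in> ?I" "i \<in> ?J" "i + 1 \<in> ?J" for r i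
    using rel[of r] that unfolding G_eq rotation_group_pow rotation_group_sel s_def
    by (simp add: rotation_relations_def)
  have order2': "(s r (i + 1) \<otimes>\<^bsub>G r\<^esub> s r i) [^]\<^bsub>G r\<^esub> (2::nat) = \<one>\<^bsub>G r\<^esub>"
    if i: "r \<in> ?I" "i \<in> ?J" "i + 1 \<in> ?J" for r i
  proof -
    interpret G: group "G r" using i by (intro grp)
    let ?x = "s r i" and ?y = "s r (i + 1)"
    have c: "?x \<in> carrier (G r)" "?y \<in> carrier (G r)" using s_in_G i by auto
    have "?x \<otimes>\<^bsub>G r\<^esub> (?y \<otimes>\<^bsub>G r\<^esub> ?x \<otimes>\<^bsub>G r\<^esub> ?y) = \<one>\<^bsub>G r\<^esub>"
      using order2[OF i] c by (simp add: numeral_2_eq_2 G.m_assoc)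
    then have "?y \<otimes>\<^bsub>G r\<^esub> ?x \<otimes>\<^bsub>G r\<^esub> ?y \<otimes>\<^bsub>G r\<^esub> ?x = \<one>\<^bsub>G r\<^esub>"
      by (rule G.inv_comm) (use c in simp_all)
    then show ?thesis using c by (simp add: numeral_2_eq_2 G.m_assoc)
  qed
  have exotic: "M.single r (s r i) \<in> M.mix" if r: "r \<in> ?I" and p: "p r \<noteq> (\<lambda>_. 3)" and i: "i \<in> ?J" for r i
  proof -
    \<comment> \<open>The exceptional index, at which the rotation has order dividing 4.\<close>
    define e where "e = (if p r = (\<lambda>_. 3)(1 := 4) then 1 else n - 1)"
    have pr: "p r = (\<lambda>_. 3)(e := 4)" using types[of r] r p by (auto simp: e_def)
    have eJ: "e \<in> ?J" using n by (auto simp: e_def)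
    have others: "p q e = 3" if q: "q \<in> ?I - {r}" for q
    proof -
      have "p q \<noteq> p r" using distinct_types q r by (metis DiffE inj_on_eq_iff insertI1)
      then have "p q \<noteq> (\<lambda>_. 3)(e := 4)" using pr by simp
      moreover have "p q = (\<lambda>_. 3) \<or> p q = (\<lambda>_. 3)(1 := 4) \<or> p q = (\<lambda>_. 3)(n - 1 := 4)"
        using types[of q] q by blast
      ultimately show ?thesis by (cases "e = 1"; cases "e = n - 1") auto
    qed
    have start: "M.single r (s r e) \<in> M.mix"
    proof (rule M.single_isolate[OF r eJ])
      show "s r e [^]\<^bsub>G r\<^esub> (4::nat) = \<one>\<^bsub>G r\<^esub>" using order[OF r eJ] pr by simp
      show "s q e [^]\<^bsub>G q\<^esub> (3::nat) = \<one>\<^bsub>G q\<^esub>" if "q \<in> ?I - {r}" for q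
        using order[of q e] others[OF that] that eJ by (metis DiffD1)
    qed
    have three: "s r i [^]\<^bsub>G r\<^esub> (3::nat) = \<one>\<^bsub>G r\<^esub>" if "i \<in> ?J" "i \<noteq> e" for i
      using order[OF r that(1)] pr that(2) by simp
    show ?thesis
    proof (cases "e = 1")
      case True
      have "1 \<le> i" "i \<le> n - 1" using i by auto
      then show ?thesis
      proof (induction i rule: dec_induct)
        case base then show ?case using start True by simp
      next
        case (step i)
        then show ?case
          using M.single_step[of r i "Suc i"] order2[of r i] three[of "Suc i"] r True by simp
      qed
    next
      case False
      then have e: "e = n - 1" by (simp add: e_def split: if_splits)
      have "i \<le> n - 1" "1 \<le> i" using i by auto
      then show ?thesis
      proof (induction i rule: inc_induct)
        case base then show ?case using start e by simp
      next
        case (step i)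
        then show ?case
          using M.single_step[of r "Suc i" i] order2'[of r i] three[of i] r e by simp
      qed
    qed
  qed
  have "M.single r (s r i) \<in> M.mix" if r: "r \<in> ?I" and i: "i \<in> ?J" for r i
  proof (cases "p r = (\<lambda>_. 3)")
    case True
    have "p q \<noteq> (\<lambda>_. 3)" if "q \<in> ?I - {r}" for q
      using distinct_types that r True by (metis DiffE inj_on_eq_iff insertI1)
    then have "M.single q (s q i) \<in> M.mix" if "q \<in> ?I - {r}" for q
      using exotic[OF _ _ i] that by (meson DiffD1)
    then show ?thesis by (rule M.single_last_factor[OF r i])
  next
    case False
    then show ?thesis using exotic r i by simp
  qed
  then have full: "M.mix = carrier (product_group ?I G)" by (rule M.mix_eqI)
  have prod: "rotation_group_product n Ps = product_group ?I G"
    by (simp add: rotation_group_product_def G_def)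
  have "M.diag i = beta Ps i" for i by (simp add: M.diag_def beta_def s_def)
  then have "{beta Ps i | i. 1 \<le> i \<and> i \<le> n - 1} = M.diag ` ?J" by auto
  then have "rotation_group_mix n Ps = (product_group ?I G)\<lparr>carrier := M.mix\<rparr>"
    by (simp only: rotation_group_mix_def prod M.mix_def)
  also have "\<dots> = product_group ?I G" unfolding full by simp
  finally show ?thesis by (simp add: prod)
qed

theorem theorem4p1:
  fixes \<Phi>T \<Phi>B \<Phi>C :: "'a::euclidean_space set set"
    and T B C :: "'a set \<times> 'a set set" and n :: nat
  assumes "n = DIM('a)" and "n \<ge> 3"
    and "T = (regular_simplex, \<Phi>T)" and "flag regular_simplex \<Phi>T"
    and "B = (cube, \<Phi>B)" and "flag cube \<Phi>B"
    and "C = (cross_polytope, \<Phi>C)" and "flag cross_polytope \<Phi>C"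
  shows "rotation_group_mix n [T, B] = rotation_group_product n [T, B] \<and>
    rotation_group_mix n [T, C] = rotation_group_product n [T, C] \<and>
    rotation_group_mix n [B, C] = rotation_group_product n [B, C] \<and>
    rotation_group_mix n [T, B, C] = rotation_group_product n [T, B, C]"
proof -
  define pT pB pC :: "nat \<Rightarrow> nat"
    where "pT = (\<lambda>_. 3)" and "pB = (\<lambda>_. 3)(1 := 4)" and "pC = (\<lambda>_. 3)(n - 1 := 4)"
  note p_defs = pT_def pB_def pC_def
  have T: "rotation_relations n pT (fst T) (snd T)"
    using simplex_rotation_relations[OF assms(4)] assms by (simp add: pT_def)
  have C: "rotation_relations n pC (fst C) (snd C)"
    using cross_polytope_rotation_relations[OF assms(8)] assms by (simp add: pC_def fun_upd_def)
  have "rotation_relations n (\<lambda>i. if n - i = n - 1 then 4 else 3) (fst B) (snd B)"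
    using cube_rotation_relations[OF assms(6)] assms by simp
  moreover have "n - i = n - 1 \<longleftrightarrow> i = 1" for i using \<open>n \<ge> 3\<close> by auto
  ultimately have B: "rotation_relations n pB (fst B) (snd B)" by (simp add: pB_def fun_upd_def)
  have distinct: "pT \<noteq> pB" "pT \<noteq> pC" "pB \<noteq> pC"
    using \<open>n \<ge> 3\<close> unfolding p_defs by (auto dest: fun_cong[of _ _ 1] fun_cong[of _ _ "n - 1"] split: if_splits)
  show ?thesis
    by (intro conjI mix_eq_product[OF \<open>n \<ge> 3\<close>, of "[pT, pB]"] mix_eq_product[OF \<open>n \<ge> 3\<close>, of "[pT, pC]"]
        mix_eq_product[OF \<open>n \<ge> 3\<close>, of "[pB, pC]"] mix_eq_product[OF \<open>n \<ge> 3\<close>, of "[pT, pB, pC]"])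
      (use T B C distinct in \<open>simp_all add: p_defs split_beta\<close>)
qed

end
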